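(* There is a constant $C_{n,s,\theta}>0$, depending only on $n,s,\theta$, for which the following holds. Let $T\subset\mathbb{R}^n$ be a hyperplane perpendicular to $\mathbf{e}$, let $\Sigma$ be the open half-space on one side of $T$, and let $\tilde x$ denote the reflection of $x$ with respect to $T$. Let $\Omega$ be an unbounded open set in $\Sigma$. Assume $w\in\mathcal{L}_s(\mathbb{R}^n)\cap C^{1,1}_{loc}(\Omega)$ is bounded from below and satisfies $$\begin{cases}\mathbf{F_s}w(x)-c(x)w(x)\le 0 & \text{at points } x\in\Omega \text{ where } w(x)<0,\\ w(x)\ge 0 & \text{in } \Sigma\setminus\Omega,\\ w(\tilde x)=-w(x) & \text{in } \Sigma\end{cases}$$ with $$\liminf_{\substack{x\in\Omega,\ w(x)<0\\ |x|\to\infty}}|x|^{2s}c(x)>-\frac{C_{n,s,\theta}}{4}.$$ Then there exist $R_0>0$ large enough and $\alpha_0\in(0,1)$ close enough to $1$ ($R_0$ and $\alpha_0$ are independent of $w$ and $\Sigma$) such that, if $\hat x\in\Omega$ satisfies $$w(\hat x)\le\alpha_0\inf_{\Omega}w(x)<0,$$ then $|\hat x|\le R_0$.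
   Context: Let $n\ge 2$, $0<s<1$ and $0<\theta\le\Theta<\infty$. $\mathcal{L}_s(\mathbb{R}^n)$ is the set of functions $u:\mathbb{R}^n\to\mathbb{R}$ with $\int_{\mathbb{R}^n}\frac{|u(x)|}{1+|x|^{n+2s}}\,dx<+\infty$. $C^{1,1}_{loc}(\Omega)$ denotes functions that are $C^1$ with locally Lipschitz gradient in $\Omega$. Fix a unit vector $\mathbf{e}\in\mathbb{R}^n$. For $u\in\mathcal{L}_s(\mathbb{R}^n)$ that is $C^{1,1}$ near $x$, $$\mathbf{F_s}u(x):=\inf\left\{P.V.\int_{\mathbb{R}^n}\frac{u(y)-u(x)}{|A^{-1}(y-x)|^{n+2s}}\,dy \;:\; A \text{ a real symmetric } n\times n \text{ matrix},\ \theta I\le A\le\Theta I,\ \mathbf{e} \text{ is an eigenvector of } A\right\}.$$ P.V. denotes the Cauchy principal value.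
   Formalization: Adds that w is lower semicontinuous on the part of the closure of Ω inside Σ (the claim fails without it); R_0 and α_0 are independent of w and Σ only among w whose negative set in Ω lies in a fixed N, with the liminf taken over N (take N = {w<0} for a single w). *)

theory Defs
  imports "HOL-Analysis.Analysis"
begin

text \<open>Measurability is required separately because integrability of the absolute value
  does not imply it.\<close>

definition Ls_space :: "real \<Rightarrow> ('a::euclidean_space \<Rightarrow> real) set" where
  "Ls_space s =
     {u. u \<in> borel_measurable lebesgue \<and>
         integrable lebesgue
           (\<lambda>x. \<bar>u x\<bar> / (1 + norm x powr (real DIM('a) + 2 * s)))}"

definition C11_loc :: "'a::euclidean_space set \<Rightarrow> ('a \<Rightarrow> real) set" where
  "C11_loc S =
     {u. \<exists>g. (\<forall>x\<in>S. GDERIV u x :> g x) \<and>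
            (\<forall>x\<in>S. \<exists>r>0. \<exists>L. ball x r \<subseteq> S \<and> L-lipschitz_on (ball x r) g)}"

text \<open>Principal value at the singularity \<open>x\<close>: Euclidean balls around \<open>x\<close> are removed,
  whatever the anisotropy of the kernel. As always with \<^const>\<open>Lim\<close>, the value is
  meaningful only where the limit exists, which is the case below for \<open>u\<close> in
  \<open>Ls_space s\<close> and \<open>C^{1,1}\<close> near \<open>x\<close>.\<close>

definition pv_integral :: "'a::euclidean_space \<Rightarrow> ('a \<Rightarrow> real) \<Rightarrow> real" where
  "pv_integral x f =
     Lim (at_right 0) (\<lambda>\<epsilon>. set_lebesgue_integral lebesgue {y. \<epsilon> < dist x y} f)"

definition admissible :: "real \<Rightarrow> real \<Rightarrow> real^'n \<Rightarrow> (real^'n^'n) set" where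
  "admissible \<theta> \<Theta> e =
     {A. transpose A = A \<and>
         (\<forall>v. \<theta> * (v \<bullet> v) \<le> v \<bullet> (A *v v) \<and> v \<bullet> (A *v v) \<le> \<Theta> * (v \<bullet> v)) \<and>
         e \<noteq> 0 \<and> (\<exists>\<mu>. A *v e = \<mu> *\<^sub>R e)}"

definition Fs :: "real \<Rightarrow> real \<Rightarrow> real \<Rightarrow> real^'n \<Rightarrow> (real^'n \<Rightarrow> real) \<Rightarrow> real^'n \<Rightarrow> real" where
  "Fs s \<theta> \<Theta> e u x =
     (INF A\<in>admissible \<theta> \<Theta> e.
        pv_integral x (\<lambda>y. (u y - u x) /
          norm (matrix_inv A *v (y - x)) powr (real CARD('n) + 2 * s)))"

text \<open>For a unit vector \<open>e\<close>, the hyperplanes perpendicular to \<open>e\<close> are the sets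
  \<open>{x. e \<bullet> x = l}\<close>.\<close>

definition hyperplane_reflection :: "'a::euclidean_space \<Rightarrow> real \<Rightarrow> 'a \<Rightarrow> 'a" where
  "hyperplane_reflection e l x = x + (2 * (l - e \<bullet> x)) *\<^sub>R e"

text \<open>The theorem assumes lower semicontinuity on \<open>closure \<Omega> \<inter> \<Sigma>\<close>, as is usual in maximum
  principles of this kind; since \<open>w\<close> is continuous in the open set \<open>\<Omega>\<close>, this constrains it only
  at boundary points of \<open>\<Omega>\<close> inside \<open>\<Sigma>\<close>. Without it the conclusion fails for \<open>s > 1/2\<close>: remove
  from \<open>\<Omega>\<close> a ray along which \<open>w\<close> tends to its infimum, while \<open>w = 0\<close> on the (null) ray.\<close>

definition lower_semicontinuous_on :: "'a::topological_space set \<Rightarrow> ('a \<Rightarrow> real) \<Rightarrow> bool" where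
  "lower_semicontinuous_on S f \<longleftrightarrow>
     (\<forall>x\<in>S. \<forall>a. a < f x \<longrightarrow> eventually (\<lambda>y. a < f y) (at x within S))"

end

theory Submission
  imports Defs
begin

text \<open>Suppose \<open>w\<close> almost attains its negative infimum \<open>-M\<close> at a far away point \<open>x\<close>. Let \<open>l0\<close> be the
  infimum of \<open>e \<bullet> y\<close> over \<open>\<Omega>\<close> and \<open>2 r = e \<bullet> x - l0\<close>; using \<open>l0\<close> instead of the position \<open>l\<close> of
  the hyperplane is what makes the estimate independent of \<open>l\<close>. Subtracting a small multiple
  \<open>a = \<eta> M\<close> of a bump of radius \<open>r\<close> around \<open>x\<close> produces a global minimum over the half-space at a
  point \<open>z \<in> \<Omega>\<close> close to \<open>x\<close>. Folding the singular integral along the hyperplane, the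
  antisymmetry of \<open>w\<close> and the inequality \<open>K(z, y') \<le> K(z, y)\<close> for mirror images \<open>y'\<close> show that the
  operator at \<open>z\<close> is at least \<open>(M - a)\<close> times the mass of the kernel on \<open>{y. e \<bullet> y \<le> l0}\<close>, up to
  the contribution of the bump; both scale like \<open>r\<close> to the power \<open>-2 s\<close>. As \<open>r \<le> 2 |z|\<close> for
  large \<open>|x|\<close>, this beats the zeroth order term once \<open>\<eta>\<close> is small.\<close>

subsection \<open>Isometric involutions preserve Lebesgue measure\<close>

text \<open>By Vitali's theorem an open set is, up to a null set, a disjoint union of balls, and an
  isometry maps balls to balls of the same radius. (The library's change of variables needs a
  well-ordered index type.)\<close>

lemma emeasure_open_le_isometric_image:
  fixes f :: "'a::euclidean_space \<Rightarrow> 'a"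
  assumes iso: "\<And>x y. dist (f x) (f y) = dist x y" and inv: "\<And>x. f (f x) = x"
    and U: "open U"
  shows "emeasure lborel U \<le> emeasure lborel (f ` U)"
proof -
  have fvim: "f ` S = f -` S" for S
    by (auto simp: inv image_iff) (metis inv)
  have cont: "continuous_on UNIV f"
    unfolding continuous_on_iff using iso by metis
  have fball: "f ` ball x r = ball (f x) r" for x r
    unfolding fvim using iso inv by (auto simp: ball_def) (metis iso inv)+
  \<comment> \<open>The Vitali family is indexed by centre and radius. Nonpositive radii are not
    excluded, so some of its balls may be empty, hence the case split in
    \<open>meas\<close>.\<close>
  define K where "K = {p::'a\<times>real. ball (fst p) (snd p) \<subseteq> U}"
  have "\<exists>i. i \<in> K \<and> x \<in> ball (fst i) (snd i) \<and> snd i < d" if "x \<in> U" "0 < d" for x d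
  proof -
    obtain e where e: "e > 0" "ball x e \<subseteq> U"
      using U \<open>x \<in> U\<close> open_contains_ball by blast
    have "ball x (min e (d/2)) \<subseteq> ball x e" by auto
    then show ?thesis
      using e that by (intro exI[of _ "(x, min e (d/2))"]) (auto simp: K_def)
  qed
  then obtain C where C: "countable C" "C \<subseteq> K"
     "pairwise (\<lambda>i j. disjnt (ball (fst i) (snd i)) (ball (fst j) (snd j))) C"
     "negligible (U - (\<Union>i\<in>C. ball (fst i) (snd i)))"
    by (rule Vitali_covering_theorem_balls[of U K fst snd])
  let ?B = "\<lambda>i::'a\<times>real. ball (fst i) (snd i)"
  have disj: "disjoint_family_on ?B C"
    using C(3) by (auto simp: pairwise_def disjoint_family_on_def disjnt_def)
  have disj': "disjoint_family_on (\<lambda>i. f ` ?B i) C"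
    using disj unfolding disjoint_family_on_def fvim by blast
  have meas: "emeasure lborel (f ` ?B i) = emeasure lborel (?B i)" for i
    unfolding fball by (cases "snd i \<le> 0") (simp_all add: ball_empty emeasure_ball)
  let ?N = "U - (\<Union>i\<in>C. ?B i)"
  have Us: "(\<Union>i\<in>C. ?B i) \<subseteq> U" using C(2) by (auto simp: K_def)
  have N: "?N \<in> sets borel" using U by (intro sets.Diff borel_open open_UN) auto
  have UB: "(\<Union>i\<in>C. ?B i) \<in> sets borel" by (intro borel_open open_UN) auto
  have N0: "emeasure lborel ?N = 0"
    using C(4) N by (simp add: negligible_iff_null_sets null_sets_completion_iff null_setsD1)
  have "emeasure lborel U = emeasure lborel ((\<Union>i\<in>C. ?B i) \<union> ?N)"
    using Us by (simp add: Un_absorb1)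
  also have "\<dots> \<le> emeasure lborel (\<Union>i\<in>C. ?B i) + emeasure lborel ?N"
    using UB N by (intro emeasure_subadditive) simp_all
  also have "\<dots> = (\<integral>\<^sup>+i. emeasure lborel (?B i) \<partial>count_space C)"
    using N0 C(1) disj by (simp add: emeasure_UN_countable)
  also have "\<dots> = (\<integral>\<^sup>+i. emeasure lborel (f ` ?B i) \<partial>count_space C)"
    by (simp only: meas)
  also have "\<dots> = emeasure lborel (\<Union>i\<in>C. f ` ?B i)"
    using C(1) disj' by (subst emeasure_UN_countable) (auto simp: fball)
  also have "\<dots> \<le> emeasure lborel (f ` U)"
  proof (rule emeasure_mono)
    show "(\<Union>i\<in>C. f ` ?B i) \<subseteq> f ` U" using Us by blast
    show "f ` U \<in> sets lborel"
      unfolding fvim using U cont by (simp add: continuous_on_open_vimage)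
  qed
  finally show ?thesis .
qed

text \<open>The one-sided estimate, applied to an open set and to its preimage (which coincides with
  its image), gives equality on open sets. Boxes then identify the image measure with
  \<open>lborel\<close>.\<close>

lemma lebesgue_isometric_involution:
  fixes f :: "'a::euclidean_space \<Rightarrow> 'a"
  assumes iso: "\<And>x y. dist (f x) (f y) = dist x y" and inv: "\<And>x. f (f x) = x"
  shows lebesgue_measurable_isometric_involution: "f \<in> lebesgue \<rightarrow>\<^sub>M lebesgue"
    and distr_lebesgue_isometric_involution: "distr lebesgue lebesgue f = lebesgue"
proof -
  have fvim: "f ` S = f -` S" for S
    by (auto simp: inv image_iff) (metis inv)
  have cont: "continuous_on UNIV f"
    unfolding continuous_on_iff using iso by metis
  then have mf[measurable]: "f \<in> borel \<rightarrow>\<^sub>M borel"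
    by (rule borel_measurable_continuous_onI)
  have eq: "emeasure lborel (f -` U) = emeasure lborel U" if U: "open U" for U
  proof (rule antisym)
    have oV: "open (f -` U)"
      using U cont by (simp add: continuous_on_open_vimage)
    have "f ` f -` U = U" by (auto simp: fvim inv)
    then show "emeasure lborel (f -` U) \<le> emeasure lborel U"
      using emeasure_open_le_isometric_image[OF iso inv oV] by simp
    show "emeasure lborel U \<le> emeasure lborel (f -` U)"
      using emeasure_open_le_isometric_image[OF iso inv U] by (simp add: fvim)
  qed
  have D: "lborel = distr lborel borel f"
  proof (rule lborel_eqI)
    fix l u :: 'a assume "\<And>b. b \<in> Basis \<Longrightarrow> l \<bullet> b \<le> u \<bullet> b"
    then show "emeasure (distr lborel borel f) (box l u) = (\<Prod>b\<in>Basis. (u - l) \<bullet> b)"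
      by (simp add: emeasure_distr eq open_box emeasure_lborel_box_eq)
  qed simp
  have mf': "f \<in> lebesgue \<rightarrow>\<^sub>M lborel"
    by (simp add: measurable_completion)
  have D': "distr lebesgue lborel f = lborel"
    by (subst (3) D) (simp add: distr_completion cong: distr_cong)
  \<comment> \<open>Measurability between the completed algebras requires preimages of null sets to
    be null; \<open>D'\<close> supplies this.\<close>
  show "f \<in> lebesgue \<rightarrow>\<^sub>M lebesgue"
    using mf' D' by (intro completion.measurable_completion2) auto
  show "distr lebesgue lebesgue f = lebesgue"
    using completion.completion_distr_eq[OF mf'] by (simp add: D')
qed

text \<open>Serves for two involutions: the point reflection about \<open>z\<close>, which leaves an
  even kernel unchanged, and the reflection in the hyperplane, under which \<open>w\<close> is
  odd.\<close>

lemma integral_symmetrize: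
  fixes f :: "'a::euclidean_space \<Rightarrow> 'a" and h :: "'a \<Rightarrow> real"
  assumes iso: "\<And>x y. dist (f x) (f y) = dist x y" and inv: "\<And>x. f (f x) = x"
    and h: "integrable lebesgue h"
  shows "integrable lebesgue (\<lambda>x. h (f x))"
    and "integral\<^sup>L lebesgue h = (\<integral>x. h x + h (f x) \<partial>lebesgue) / 2"
proof -
  note mf[measurable] = lebesgue_measurable_isometric_involution[of f, OF iso inv]
  note D = distr_lebesgue_isometric_involution[of f, OF iso inv]
  have hm[measurable]: "h \<in> borel_measurable lebesgue" using h by simp
  show 1: "integrable lebesgue (\<lambda>x. h (f x))"
    using integrable_distr_eq[OF mf hm] h by (simp add: D)
  have "(\<integral>x. h (f x) \<partial>lebesgue) = integral\<^sup>L lebesgue h"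
    using integral_distr[OF mf hm] by (simp add: D)
  then show "integral\<^sup>L lebesgue h = (\<integral>x. h x + h (f x) \<partial>lebesgue) / 2"
    using h 1 by simp
qed

subsection \<open>The truncated power kernel\<close>

lemma dyadic_pos_power:
  assumes "1 \<le> (u::real)"
  obtains k where "2 ^ k \<le> u" "u < 2 ^ Suc k"
proof -
  obtain n where n: "u < 2 ^ n" using real_arch_pow[of 2 u] by (meson one_less_numeral_iff semiring_norm(76))
  define m where "m = (LEAST n. u < 2 ^ n)"
  have m: "u < 2 ^ m" unfolding m_def using n by (rule LeastI)
  with assms have "m \<noteq> 0" by (cases "m = 0") auto
  then obtain k where k: "m = Suc k" by (cases m) auto
  have "\<not> u < 2 ^ k" using not_less_Least[of k "\<lambda>n. u < 2 ^ n"] k by (simp add: m_def)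
  then show ?thesis using that[of k] m unfolding k by simp
qed

lemma dyadic_neg_power:
  assumes "0 < (u::real)" "u < 1"
  obtains k where "(1/2) ^ Suc k \<le> u" "u < (1/2) ^ k"
proof -
  have "\<exists>n. (1/2) ^ n < u"
    by (rule real_arch_pow_inv) (use assms in simp_all)
  then obtain n where "(1/2) ^ n < u" by blast
  then have n: "(1/2) ^ n \<le> u" by (rule less_imp_le)
  define m where "m = (LEAST n. (1/2) ^ n \<le> u)"
  have m: "(1/2) ^ m \<le> u" unfolding m_def using n by (rule LeastI)
  with assms have "m \<noteq> 0" by (cases "m = 0") auto
  then obtain k where k: "m = Suc k" by (cases m) auto
  have "k < m" using k by simp
  then have "\<not> (1/2) ^ k \<le> u"
    unfolding m_def by (rule not_less_Least)
  then show ?thesis using that[of k] m unfolding k by simp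
qed

text \<open>Here \<open>u\<close> is a distance in units of \<open>r\<close>. The function is at
  most \<open>u powr (-q)\<close> and at most \<open>u powr (2 - q)\<close>, both nonincreasing
  because \<open>2 \<le> q\<close>. The first is used for \<open>1 \<le> u\<close>, the second for
  \<open>u < 1\<close>, each evaluated at the largest power of two not exceeding
  \<open>u\<close>.\<close>

lemma truncated_power_le_dyadic:
  fixes u q :: real
  assumes "0 < u" "2 \<le> q"
  shows "\<exists>k. (u < 2 ^ Suc k \<and> min 1 (u\<^sup>2) * u powr (-q) \<le> (2 powr (-q)) ^ k) \<or>
             (u < (1/2) ^ k \<and> min 1 (u\<^sup>2) * u powr (-q) \<le> (2 powr (q - 2)) ^ Suc k)"
proof (cases "1 \<le> u")
  case True
  then obtain k where k: "2 ^ k \<le> u" "u < 2 ^ Suc k" by (rule dyadic_pos_power)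
  have "min 1 (u\<^sup>2) * u powr (-q) \<le> 1 * u powr (-q)"
    by (intro mult_right_mono) auto
  also have "\<dots> \<le> (2 ^ k) powr (-q)"
    using k assms by (auto intro!: powr_mono2')
  also have "\<dots> = (2 powr (-q)) ^ k"
  proof -
    have "(2 ^ k :: real) = 2 powr real k" "(2 powr (-q)) ^ k = (2 powr (-q)) powr real k"
      by (simp_all add: powr_realpow)
    then show ?thesis by (simp only: powr_powr mult.commute)
  qed
  finally show ?thesis using k by blast
next
  case False
  then obtain k where k: "(1/2) ^ Suc k \<le> u" "u < (1/2) ^ k"
    using assms dyadic_neg_power[of u] by (metis not_le)
  have "min 1 (u\<^sup>2) * u powr (-q) \<le> u\<^sup>2 * u powr (-q)"
    by (intro mult_right_mono) auto
  also have "\<dots> = u powr (2 - q)"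
  proof -
    have "u\<^sup>2 = u powr 2" using assms by (simp add: powr_numeral)
    then show ?thesis by (simp only: powr_add[symmetric] diff_conv_add_uminus)
  qed
  also have "\<dots> \<le> ((1/2) ^ Suc k) powr (2 - q)"
    using k assms by (intro powr_mono2') auto
  also have "\<dots> = (2 powr (q - 2)) ^ Suc k"
  proof -
    have "(1/2::real) ^ Suc k = 2 powr (- real (Suc k))"
      using powr_realpow[of 2 "Suc k"]
      by (simp only: powr_minus power_one_over inverse_eq_divide zero_less_numeral simp_thms)
    moreover have "(2 powr (q - 2)) ^ Suc k = (2 powr (q - 2)) powr real (Suc k)"
      by (rule powr_realpow[symmetric]) simp
    moreover have "- real (Suc k) * (2 - q) = (q - 2) * real (Suc k)"
      by (simp add: algebra_simps del: of_nat_Suc)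
    ultimately show ?thesis by (simp only: powr_powr)
  qed
  finally show ?thesis using k by blast
qed

text \<open>The dyadic bounds, summed over concentric balls, give two geometric series. In dimension
  \<open>n\<close> their ratios are \<open>2 powr (n - q)\<close> and
  \<open>2 powr (q - 2 - n)\<close>: the first is below 1 by decay at infinity, the second because
  the quadratic cutoff beats the singularity at \<open>z\<close>. Scaling produces the power of
  \<open>r\<close>, with \<open>C\<close> uniform in \<open>z\<close> and \<open>r\<close>.\<close>

lemma truncated_kernel_integrable:
  fixes q :: real
  assumes q: "real DIM('a::euclidean_space) < q" "q < real DIM('a) + 2" "2 \<le> q"
  obtains C where "0 \<le> C"
    "\<And>(z::'a) r. 0 < r \<Longrightarrow> integrable lebesgue (\<lambda>y. min 1 ((dist z y / r)\<^sup>2) * dist z y powr (-q))"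
    "\<And>(z::'a) r. 0 < r \<Longrightarrow>
       (\<integral>y. min 1 ((dist z y / r)\<^sup>2) * dist z y powr (-q) \<partial>lebesgue) \<le> C * r powr (real DIM('a) - q)"
proof -
  let ?n = "DIM('a)"
  let ?\<omega> = "unit_ball_vol (real ?n)"
  \<comment> \<open>Contribution of the two balls of index \<open>k\<close>, once the unit ball
    volume and the power of \<open>r\<close> have been factored out.\<close>
  define c where "c k = 2 ^ ?n * (2 powr (real ?n - q)) ^ k + 
      2 powr (q - 2) * (2 powr (q - 2 - real ?n)) ^ k" for k
  have csum: "summable c"
    unfolding c_def using q
    by (intro summable_add summable_mult summable_geometric) (auto simp: powr_less_one)
  have c0: "c k \<ge> 0" for k unfolding c_def by (intro add_nonneg_nonneg mult_nonneg_nonneg) auto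
  define C where "C = ?\<omega> * suminf c"
  have C0: "C \<ge> 0" unfolding C_def using csum c0 by (simp add: suminf_nonneg)
  have main: "(\<integral>\<^sup>+y. ennreal (min 1 ((dist z y / r)\<^sup>2) * dist z y powr (-q)) \<partial>lebesgue)
      \<le> ennreal (C * r powr (real ?n - q))" if r: "0 < r" for z :: 'a and r
  proof -
    define a where "a k = r powr (-q) * (2 powr (-q)) ^ k" for k
    define b where "b k = r powr (-q) * (2 powr (q - 2)) ^ Suc k" for k
    have ab: "a k \<ge> 0" "b k \<ge> 0" for k by (auto simp: a_def b_def)
    let ?A = "\<lambda>k. ball z (2 ^ Suc k * r)" and ?B = "\<lambda>k. ball z ((1/2) ^ k * r)"
    let ?f = "\<lambda>k y. ennreal (a k) * indicator (?A k) y + ennreal (b k) * indicator (?B k) y"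
    have pw: "ennreal (min 1 ((dist z y / r)\<^sup>2) * dist z y powr (-q)) \<le> (\<Sum>k. ?f k y)" for y
    proof (cases "dist z y = 0")
      case False
      define u where "u = dist z y / r"
      have u: "u > 0" using False r by (simp add: u_def)
      have eq: "min 1 ((dist z y / r)\<^sup>2) * dist z y powr (-q) = r powr (-q) * (min 1 (u\<^sup>2) * u powr (-q))"
      proof -
        have "dist z y = r * u" using r by (simp add: u_def)
        then have "dist z y powr (-q) = r powr (-q) * u powr (-q)"
          using u r by (simp add: powr_mult)
        then show ?thesis by (simp add: u_def)
      qed
      obtain k where k: "(u < 2 ^ Suc k \<and> min 1 (u\<^sup>2) * u powr (-q) \<le> (2 powr (-q)) ^ k) \<or>
             (u < (1/2) ^ k \<and> min 1 (u\<^sup>2) * u powr (-q) \<le> (2 powr (q - 2)) ^ Suc k)"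
        using truncated_power_le_dyadic[OF u q(3)] by blast
      have "ennreal (r powr (-q) * (min 1 (u\<^sup>2) * u powr (-q))) \<le> ?f k y"
        using k
      proof
        assume *: "u < 2 ^ Suc k \<and> min 1 (u\<^sup>2) * u powr (-q) \<le> (2 powr (-q)) ^ k"
        then have "y \<in> ?A k" using r by (simp add: u_def field_simps)
        then have "ennreal (a k) \<le> ?f k y" by simp
        moreover have "r powr (-q) * (min 1 (u\<^sup>2) * u powr (-q)) \<le> a k"
          unfolding a_def using * by (intro mult_left_mono) auto
        ultimately show ?thesis using ennreal_leI order_trans by blast
      next
        assume *: "u < (1/2) ^ k \<and> min 1 (u\<^sup>2) * u powr (-q) \<le> (2 powr (q - 2)) ^ Suc k"
        then have "y \<in> ?B k" using r by (simp add: u_def field_simps)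
        then have "ennreal (b k) \<le> ?f k y" by simp
        moreover have "r powr (-q) * (min 1 (u\<^sup>2) * u powr (-q)) \<le> b k"
          unfolding b_def using * by (intro mult_left_mono) auto
        ultimately show ?thesis using ennreal_leI order_trans by blast
      qed
      also have "\<dots> \<le> (\<Sum>k. ?f k y)"
        using sum_le_suminf[of "\<lambda>k. ?f k y" "{k}"] by simp
      finally show ?thesis by (simp only: eq)
    qed simp
    have ballm[measurable]: "ball z t \<in> sets lebesgue" for t
      using lmeasurable_ball by (rule fmeasurableD)
    have term_eq: "(\<integral>\<^sup>+y. ?f k y \<partial>lebesgue) = ennreal (?\<omega> * r powr (real ?n - q) * c k)" for k
    proof -
      have pn: "r ^ ?n = r powr real ?n" "2 ^ ?n = (2::real) powr real ?n"
        using r by (simp_all add: powr_realpow)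
      have "(\<integral>\<^sup>+y. ?f k y \<partial>lebesgue)
          = ennreal (a k) * emeasure lebesgue (?A k) + ennreal (b k) * emeasure lebesgue (?B k)"
        using ballm by (subst nn_integral_add) (auto simp: nn_integral_cmult_indicator)
      also have "\<dots> = ennreal (a k * (?\<omega> * (2 ^ Suc k * r) ^ ?n) + b k * (?\<omega> * ((1/2) ^ k * r) ^ ?n))"
        using r ab by (simp add: emeasure_ball ennreal_mult'[symmetric] ennreal_plus[symmetric] 
            del: ennreal_plus power_Suc)
      also have "a k * (?\<omega> * (2 ^ Suc k * r) ^ ?n) + b k * (?\<omega> * ((1/2) ^ k * r) ^ ?n)
          = ?\<omega> * r powr (real ?n - q) * c k"
      proof -
        have 1: "(2 powr (-q)) ^ k * (2 ^ Suc k) ^ ?n = 2 ^ ?n * (2 powr (real ?n - q)) ^ k"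
        proof -
          have "2 powr (real ?n - q) = 2 powr (-q) * 2 ^ ?n"
            unfolding pn by (simp add: powr_add[symmetric])
          then show ?thesis by (simp add: power_mult_distrib power_mult[symmetric] mult.commute)
        qed
        have 2: "(2 powr (q - 2)) ^ Suc k * ((1/2) ^ k) ^ ?n
            = 2 powr (q - 2) * (2 powr (q - 2 - real ?n)) ^ k"
        proof -
          have "2 powr (q - 2 - real ?n) = 2 powr (q - 2) * (1/2) ^ ?n"
            by (simp add: powr_diff powr_realpow power_one_over)
          then show ?thesis by (simp add: power_mult_distrib power_mult[symmetric] mult.commute)
        qed
        have 3: "r powr (real ?n - q) = r powr (-q) * r ^ ?n"
          unfolding pn by (simp add: powr_add[symmetric])
        have "a k * (?\<omega> * (2 ^ Suc k * r) ^ ?n) = ?\<omega> * (r powr (-q) * r ^ ?n) * ((2 powr (-q)) ^ k * (2 ^ Suc k) ^ ?n)"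
          unfolding a_def power_mult_distrib[of "2 ^ Suc k"] by (simp only: ac_simps)
        moreover have "b k * (?\<omega> * ((1/2) ^ k * r) ^ ?n) = 
            ?\<omega> * (r powr (-q) * r ^ ?n) * ((2 powr (q - 2)) ^ Suc k * ((1/2) ^ k) ^ ?n)"
          unfolding b_def power_mult_distrib[of "(1/2) ^ k"] by (simp only: ac_simps)
        ultimately show ?thesis unfolding 1 2 3 c_def by (simp only: distrib_left)
      qed
      finally show ?thesis .
    qed
    have "(\<integral>\<^sup>+y. ennreal (min 1 ((dist z y / r)\<^sup>2) * dist z y powr (-q)) \<partial>lebesgue)
        \<le> (\<integral>\<^sup>+y. (\<Sum>k. ?f k y) \<partial>lebesgue)"
      by (intro nn_integral_mono pw)
    also have "\<dots> = (\<Sum>k. \<integral>\<^sup>+y. ?f k y \<partial>lebesgue)"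
      by (intro nn_integral_suminf) measurable
    also have "\<dots> = (\<Sum>k. ennreal (?\<omega> * r powr (real ?n - q) * c k))"
      by (simp only: term_eq)
    also have "\<dots> = ennreal (\<Sum>k. ?\<omega> * r powr (real ?n - q) * c k)"
      using csum c0 by (intro suminf_ennreal_eq summable_sums summable_mult) auto
    also have "(\<Sum>k. ?\<omega> * r powr (real ?n - q) * c k) = C * r powr (real ?n - q)"
      using csum by (simp add: suminf_mult C_def)
    finally show ?thesis .
  qed
  have meas: "(\<lambda>y. min 1 ((dist z y / r)\<^sup>2) * dist z y powr (-q)) \<in> borel_measurable lebesgue"
    for z :: 'a and r
    by (rule measurable_completion) measurable
  have int: "integrable lebesgue (\<lambda>y. min 1 ((dist z y / r)\<^sup>2) * dist z y powr (-q))"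
    if "0 < r" for z :: 'a and r
    using main[OF that, of z] by (intro integrableI_nonneg meas) (auto intro: le_less_trans)
  show ?thesis
  proof (rule that[OF C0 int])
    fix z :: 'a and r :: real assume r: "0 < r"
    show "(\<integral>y. min 1 ((dist z y / r)\<^sup>2) * dist z y powr (-q) \<partial>lebesgue) \<le> C * r powr (real ?n - q)"
      using main[OF r, of z] C0 
      by (subst integral_eq_nn_integral[OF meas]) (auto intro!: enn2real_leI)
  qed
qed

subsection \<open>Principal values for even kernels\<close>

abbreviation trunc_power :: "real \<Rightarrow> 'a::euclidean_space \<Rightarrow> real \<Rightarrow> 'a \<Rightarrow> real" where
  "trunc_power q z r y \<equiv> min 1 ((dist z y / r)\<^sup>2) * dist z y powr (-q)"

text \<open>The intended instance is \<open>norm (matrix_inv A *v h) powr (-q)\<close> with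
  \<open>\<Lambda> = \<Theta> powr q\<close>. Since \<open>0 powr (-q) = 0\<close>, the upper bound
  forces \<open>k 0 = 0\<close>.\<close>

locale even_kernel =
  fixes k :: "'a::euclidean_space \<Rightarrow> real" and s \<Lambda> q :: real
  assumes dim: "DIM('a) \<ge> 2" and s: "0 < s" "s < 1"
    and q: "q = real DIM('a) + 2 * s"
    and k_measurable [measurable]: "k \<in> borel_measurable borel"
    and k_even: "k (- h) = k h"
    and k_nonneg: "0 \<le> k h"
    and k_bound: "k h \<le> \<Lambda> * norm h powr (-q)"
begin

lemma Lambda_nonneg: "0 \<le> \<Lambda>"
proof -
  obtain b :: 'a where "b \<in> Basis" using nonempty_Basis by blast
  then show ?thesis using k_bound[of b] k_nonneg[of b] by simp
qed

lemma k_shift_measurable [measurable]: "(\<lambda>y. k (y - z)) \<in> borel_measurable lebesgue"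
  by (rule measurable_completion) measurable

lemma k_shift_bound: "k (y - z) \<le> \<Lambda> * dist z y powr (-q)"
  using k_bound[of "y - z"] by (simp add: dist_norm norm_minus_commute)

lemma trunc_power_integrable: "0 < r \<Longrightarrow> integrable lebesgue (trunc_power q (z::'a) r)"
proof -
  assume r: "0 < r"
  have "real DIM('a) < q" "q < real DIM('a) + 2" "2 \<le> q" using dim s q by auto
  then show ?thesis
  proof (rule truncated_kernel_integrable)
    assume "\<And>(z::'a) r. 0 < r \<Longrightarrow> integrable lebesgue (trunc_power q z r)"
    from this[OF r] show ?thesis .
  qed
qed

lemma exterior_sets [measurable]: "{y. \<epsilon> < dist z y} \<in> sets lebesgue"
proof -
  have "{y. \<epsilon> < dist z y} = - cball z \<epsilon>" by auto
  then show ?thesis by (metis borel_closed closed_cball sets.compl_sets Compl_eq_Diff_UNIV space_borel sets_completionI_sets sets_lborel)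
qed

lemma k_tail_integrable:
  assumes "0 < \<epsilon>"
  shows "integrable lebesgue (\<lambda>y. indicator {y. \<epsilon> < dist z y} y * k (y - z))"
proof (rule Bochner_Integration.integrable_bound)
  show "integrable lebesgue (\<lambda>y. \<Lambda> * trunc_power q z \<epsilon> y)"
    by (intro integrable_mult_right trunc_power_integrable assms)
  show "AE y in lebesgue. norm (indicator {y. \<epsilon> < dist z y} y * k (y - z)) \<le> norm (\<Lambda> * trunc_power q z \<epsilon> y)"
  proof (rule AE_I2)
    fix y
    show "norm (indicator {y. \<epsilon> < dist z y} y * k (y - z)) \<le> norm (\<Lambda> * trunc_power q z \<epsilon> y)"
    proof (cases "\<epsilon> < dist z y")
      case True
      then have "1 \<le> (dist z y / \<epsilon>)\<^sup>2"
        using assms by (intro one_le_power) (simp add: field_simps)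
      then have "min 1 ((dist z y / \<epsilon>)\<^sup>2) = 1" by (rule min_absorb1)
      then have "norm (\<Lambda> * trunc_power q z \<epsilon> y) = \<Lambda> * dist z y powr (-q)"
        using Lambda_nonneg by simp
      then show ?thesis
        using True k_nonneg k_shift_bound[of y z] by simp
    qed simp
  qed
qed measurable

text \<open>Away from \<open>z\<close> the kernel is dominated by a multiple of the weight
  \<open>1 / (1 + norm y powr q)\<close> that defines \<open>Ls_space\<close>; the multiple depends
  on \<open>\<epsilon>\<close> and \<open>z\<close>.\<close>

lemma Ls_tail_integrable:
  assumes w: "w \<in> Ls_space s" and \<epsilon>: "0 < \<epsilon>"
  shows "integrable lebesgue (\<lambda>y. indicator {y. \<epsilon> < dist z y} y * (w y * k (y - z)))"
proof (rule Bochner_Integration.integrable_bound)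
  \<comment> \<open>For \<open>t = dist z y > \<epsilon>\<close>, multiplying by
    \<open>t powr q\<close> makes the first summand at least 1 and the second at least
    \<open>norm y powr q\<close>.\<close>
  define c where "c = \<epsilon> powr (-q) + ((\<epsilon> + norm z) / \<epsilon>) powr q"
  have c: "c \<ge> 0" by (simp add: c_def)
  have wm[measurable]: "w \<in> borel_measurable lebesgue"
    and wi: "integrable lebesgue (\<lambda>x. \<bar>w x\<bar> / (1 + norm x powr q))"
    using w by (auto simp: Ls_space_def q)
  show "integrable lebesgue (\<lambda>y. \<Lambda> * c * (\<bar>w y\<bar> / (1 + norm y powr q)))"
    using wi by (rule integrable_mult_right)
  show "AE y in lebesgue. norm (indicator {y. \<epsilon> < dist z y} y * (w y * k (y - z)))
      \<le> norm (\<Lambda> * c * (\<bar>w y\<bar> / (1 + norm y powr q)))"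
  proof (rule AE_I2)
    fix y
    show "norm (indicator {y. \<epsilon> < dist z y} y * (w y * k (y - z)))
      \<le> norm (\<Lambda> * c * (\<bar>w y\<bar> / (1 + norm y powr q)))"
    proof (cases "\<epsilon> < dist z y")
      case True
      let ?t = "dist z y"
      have t: "0 < ?t" using True \<epsilon> by linarith
      have q0: "q > 0" using s q by (simp add: add_nonneg_pos)
      have ny: "norm y \<le> norm z + ?t"
        by (metis dist_norm norm_minus_commute norm_triangle_sub)
      have "norm z * \<epsilon> \<le> norm z * ?t" using True by (intro mult_left_mono) auto
      then have "norm y \<le> ?t * ((\<epsilon> + norm z) / \<epsilon>)"
        using mult_left_mono[OF ny, of \<epsilon>] \<epsilon> by (simp add: field_simps)
      then have "norm y powr q \<le> (?t * ((\<epsilon> + norm z) / \<epsilon>)) powr q"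
        using q0 by (intro powr_mono2) auto
      also have "\<dots> = ?t powr q * ((\<epsilon> + norm z) / \<epsilon>) powr q"
        using t \<epsilon> by (intro powr_mult)
      finally have 1: "norm y powr q \<le> ?t powr q * ((\<epsilon> + norm z) / \<epsilon>) powr q" .
      have "1 = \<epsilon> powr q * \<epsilon> powr (-q)" using \<epsilon> by (simp add: powr_add[symmetric])
      also have "\<dots> \<le> ?t powr q * \<epsilon> powr (-q)"
        using True \<epsilon> q0 by (intro mult_right_mono powr_mono2) auto
      finally have 2: "1 + norm y powr q \<le> ?t powr q * c"
        using 1 by (simp add: c_def distrib_left)
      have pos: "0 < 1 + norm y powr q" by (simp add: add_pos_nonneg)
      have "?t powr (-q) * (1 + norm y powr q) \<le> ?t powr (-q) * (?t powr q * c)"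
        using 2 by (intro mult_left_mono) auto
      also have "\<dots> = c" using t by (simp add: powr_minus)
      finally have 3: "?t powr (-q) \<le> c / (1 + norm y powr q)"
        using pos by (simp add: field_simps)
      have "k (y - z) \<le> \<Lambda> * (c / (1 + norm y powr q))"
        using k_shift_bound[of y z] mult_left_mono[OF 3 Lambda_nonneg] by linarith
      then have "\<bar>w y\<bar> * k (y - z) \<le> \<bar>w y\<bar> * (\<Lambda> * (c / (1 + norm y powr q)))"
        by (intro mult_left_mono) auto
      then show ?thesis
        using True k_nonneg c Lambda_nonneg pos by (simp add: abs_mult mult_ac)
    qed simp
  qed
  show "(\<lambda>y. indicator {y. \<epsilon> < dist z y} y * (w y * k (y - z))) \<in> borel_measurable lebesgue"
    by measurable
qed

text \<open>The reflection about \<open>z\<close> preserves the truncated domain and the even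
  kernel. Averaging turns first differences into second differences, in which the linear term at
  \<open>z\<close> cancels.\<close>

lemma central_symmetrization:
  assumes u: "integrable lebesgue (\<lambda>y. indicator {y. \<epsilon> < dist z y} y * ((u y - u z) * k (y - z)))"
  shows "integrable lebesgue (\<lambda>y. indicator {y. \<epsilon> < dist z y} y * ((u y + u (2 *\<^sub>R z - y) - 2 * u z) * k (y - z)))"
    and "(\<integral>y. indicator {y. \<epsilon> < dist z y} y * ((u y - u z) * k (y - z)) \<partial>lebesgue)
      = (\<integral>y. indicator {y. \<epsilon> < dist z y} y * ((u y + u (2 *\<^sub>R z - y) - 2 * u z) * k (y - z)) \<partial>lebesgue) / 2"
proof -
  let ?S = "\<lambda>y. 2 *\<^sub>R z - y"
  let ?h = "\<lambda>y. indicator {y. \<epsilon> < dist z y} y * ((u y - u z) * k (y - z))"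
  have iso: "dist (?S x) (?S y) = dist x y" for x y
    by (simp add: dist_norm norm_minus_commute)
  have inv: "?S (?S x) = x" for x by simp
  have d: "dist z (?S y) = dist z y" for y
    using iso[of z y] by (simp add: scaleR_2)
  have kS: "k (?S y - z) = k (y - z)" for y
    using k_even[of "y - z"] by (simp add: scaleR_2)
  have eq: "?h y + ?h (?S y)
      = indicator {y. \<epsilon> < dist z y} y * ((u y + u (2 *\<^sub>R z - y) - 2 * u z) * k (y - z))" for y
    unfolding kS by (simp add: d indicator_def algebra_simps)
  note sym = integral_symmetrize[OF iso inv u]
  show "integrable lebesgue (\<lambda>y. indicator {y. \<epsilon> < dist z y} y * ((u y + u (2 *\<^sub>R z - y) - 2 * u z) * k (y - z)))"
    using Bochner_Integration.integrable_add[OF u sym(1)] unfolding eq .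
  show "(\<integral>y. ?h y \<partial>lebesgue)
      = (\<integral>y. indicator {y. \<epsilon> < dist z y} y * ((u y + u (2 *\<^sub>R z - y) - 2 * u z) * k (y - z)) \<partial>lebesgue) / 2"
    using sym(2) unfolding eq .
qed

lemma Ls_difference_tail_integrable:
  assumes w: "w \<in> Ls_space s" and \<epsilon>: "0 < \<epsilon>"
  shows "integrable lebesgue (\<lambda>y. indicator {y. \<epsilon> < dist z y} y * ((w y - b) * k (y - z)))"
proof -
  have "integrable lebesgue (\<lambda>y. indicator {y. \<epsilon> < dist z y} y * (w y * k (y - z))
      - b * (indicator {y. \<epsilon> < dist z y} y * k (y - z)))"
    using Ls_tail_integrable[OF w \<epsilon>] k_tail_integrable[OF \<epsilon>]
    by (intro Bochner_Integration.integrable_diff integrable_mult_right)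
  then show ?thesis by (simp add: algebra_simps)
qed

text \<open>After symmetrization the integrand \<open>G\<close> is integrable on the whole space:
  near \<open>z\<close> the quadratic second difference compensates the kernel, elsewhere the tail
  estimate applies. Dominated convergence then gives half the integral of \<open>G\<close> as limit.
  Without convergence the \<open>Lim\<close> in \<open>pv_integral\<close> would carry no
  information.\<close>

lemma principal_value_converges:
  assumes w: "w \<in> Ls_space s" and r: "0 < r" and L: "0 \<le> L"
    and second: "\<And>h. norm h < r \<Longrightarrow> \<bar>w (z + h) + w (z - h) - 2 * w z\<bar> \<le> L * (norm h)\<^sup>2"
  obtains J where "((\<lambda>\<epsilon>. set_lebesgue_integral lebesgue {y. \<epsilon> < dist z y}
      (\<lambda>y. (w y - w z) * k (y - z))) \<longlongrightarrow> J) (at_right 0)"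
proof -
  define G where "G y = (w y + w (2 *\<^sub>R z - y) - 2 * w z) * k (y - z)" for y
  let ?D = "\<lambda>\<epsilon>. {y. \<epsilon> < dist z y}"
  have tail: "integrable lebesgue (\<lambda>y. indicator (?D \<epsilon>) y * G y)"
    "(\<integral>y. indicator (?D \<epsilon>) y * ((w y - w z) * k (y - z)) \<partial>lebesgue)
      = (\<integral>y. indicator (?D \<epsilon>) y * G y \<partial>lebesgue) / 2" if "0 < \<epsilon>" for \<epsilon>
    unfolding G_def using central_symmetrization[OF Ls_difference_tail_integrable[OF w that]] by this
  have wm[measurable]: "w \<in> borel_measurable lebesgue"
    using w by (auto simp: Ls_space_def q)
  have Gm[measurable]: "G \<in> borel_measurable lebesgue"
  proof -
    have iso: "dist (2 *\<^sub>R z - x) (2 *\<^sub>R z - y) = dist x y" for x y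
      by (simp add: dist_norm norm_minus_commute)
    have [measurable]: "(\<lambda>y. 2 *\<^sub>R z - y) \<in> lebesgue \<rightarrow>\<^sub>M lebesgue"
      by (rule lebesgue_measurable_isometric_involution) (simp_all add: iso)
    show ?thesis unfolding G_def by measurable
  qed
  \<comment> \<open>Halving \<open>r\<close> places the closed ball of radius \<open>\<rho>\<close>
    inside the open ball where \<open>second\<close> holds.\<close>
  define \<rho> where "\<rho> = r / 2"
  have \<rho>: "0 < \<rho>" "\<rho> < r" using r by (auto simp: \<rho>_def)
  have near: "\<bar>G y\<bar> \<le> L * \<Lambda> * \<rho>\<^sup>2 * trunc_power q z \<rho> y" if "\<not> \<rho> < dist z y" for y
  proof -
    let ?t = "dist z y"
    have "norm (y - z) < r" using that \<rho> by (simp add: dist_norm norm_minus_commute)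
    from second[OF this] have "\<bar>w y + w (2 *\<^sub>R z - y) - 2 * w z\<bar> \<le> L * ?t\<^sup>2"
      by (simp add: dist_norm norm_minus_commute scaleR_2 algebra_simps)
    then have "\<bar>G y\<bar> \<le> (L * ?t\<^sup>2) * (\<Lambda> * ?t powr (-q))"
      unfolding G_def abs_mult
      using k_nonneg[of "y - z"] k_shift_bound[of y z] L by (intro mult_mono) auto
    also have "(?t / \<rho>)\<^sup>2 \<le> 1"
      using that \<rho> by (intro power_le_one) auto
    then have "trunc_power q z \<rho> y = ?t\<^sup>2 / \<rho>\<^sup>2 * ?t powr (-q)"
      by (simp add: min_absorb2 power_divide)
    then have "(L * ?t\<^sup>2) * (\<Lambda> * ?t powr (-q)) = L * \<Lambda> * \<rho>\<^sup>2 * trunc_power q z \<rho> y"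
      using \<rho> by simp
    finally show ?thesis .
  qed
  have Gi: "integrable lebesgue G"
  proof (rule Bochner_Integration.integrable_bound)
    show "integrable lebesgue (\<lambda>y. \<bar>indicator (?D \<rho>) y * G y\<bar> + L * \<Lambda> * \<rho>\<^sup>2 * trunc_power q z \<rho> y)"
      using tail(1)[OF \<rho>(1)] trunc_power_integrable[OF \<rho>(1)]
      by (intro Bochner_Integration.integrable_add integrable_abs integrable_mult_right)
    show "AE y in lebesgue. norm (G y) \<le> norm (\<bar>indicator (?D \<rho>) y * G y\<bar> + L * \<Lambda> * \<rho>\<^sup>2 * trunc_power q z \<rho> y)"
    proof (rule AE_I2)
      fix y
      have nn: "0 \<le> L * \<Lambda> * \<rho>\<^sup>2 * trunc_power q z \<rho> y" using L Lambda_nonneg by simp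
      show "norm (G y) \<le> norm (\<bar>indicator (?D \<rho>) y * G y\<bar> + L * \<Lambda> * \<rho>\<^sup>2 * trunc_power q z \<rho> y)"
        using near[of y] nn by (cases "\<rho> < dist z y") auto
    qed
  qed measurable
  have "((\<lambda>\<epsilon>. \<integral>y. indicator (?D \<epsilon>) y * G y \<partial>lebesgue) \<longlongrightarrow> integral\<^sup>L lebesgue G) (at_right 0)"
    unfolding tendsto_at_iff_sequentially comp_def
  proof (intro allI impI)
    fix X :: "nat \<Rightarrow> real" assume X: "\<forall>i. X i \<in> {0<..} - {0}" "X \<longlonglongrightarrow> 0"
    show "(\<lambda>i. \<integral>y. indicator (?D (X i)) y * G y \<partial>lebesgue) \<longlonglongrightarrow> integral\<^sup>L lebesgue G"
    proof (rule integral_dominated_convergence[where w="\<lambda>y. \<bar>G y\<bar>"])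
      show "AE y in lebesgue. (\<lambda>i. indicator (?D (X i)) y * G y) \<longlonglongrightarrow> G y"
      proof (rule AE_I2)
        fix y
        show "(\<lambda>i. indicator (?D (X i)) y * G y) \<longlonglongrightarrow> G y"
        proof (cases "y = z")
          \<comment> \<open>At \<open>y = z\<close> the indicator is always 0, which agrees with
            \<open>G z = 0\<close> because the second difference vanishes there.\<close>
          case True
          then show ?thesis by (simp add: G_def scaleR_2)
        next
          case False
          then have "\<forall>\<^sub>F i in sequentially. X i < dist z y"
            using X(2) by (intro order_tendstoD) auto
          then have "\<forall>\<^sub>F i in sequentially. indicator (?D (X i)) y * G y = G y"
            by eventually_elim simp
          then show ?thesis by (rule tendsto_eventually)
        qed
      qed
      show "AE y in lebesgue. norm (indicator (?D (X i)) y * G y) \<le> \<bar>G y\<bar>" for i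
        by (simp add: indicator_def)
    qed (use Gi in auto)
  qed
  then have "((\<lambda>\<epsilon>. (\<integral>y. indicator (?D \<epsilon>) y * G y \<partial>lebesgue) / 2) \<longlongrightarrow> integral\<^sup>L lebesgue G / 2) (at_right 0)"
    by (intro tendsto_divide tendsto_const) auto
  moreover have "\<forall>\<^sub>F \<epsilon> in at_right 0. (\<integral>y. indicator (?D \<epsilon>) y * G y \<partial>lebesgue) / 2 = 
      set_lebesgue_integral lebesgue (?D \<epsilon>) (\<lambda>y. (w y - w z) * k (y - z))"
    using tail(2) by (auto simp: eventually_at_filter set_lebesgue_integral_def intro!: always_eventually)
  ultimately have "((\<lambda>\<epsilon>. set_lebesgue_integral lebesgue (?D \<epsilon>) (\<lambda>y. (w y - w z) * k (y - z)))
      \<longlongrightarrow> integral\<^sup>L lebesgue G / 2) (at_right 0)"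
    by (rule Lim_transform_eventually)
  then show ?thesis by (rule that)
qed

end

subsection \<open>Lower bound for antisymmetric functions\<close>

lemma inner_hyperplane_reflection:
  assumes "norm e = 1"
  shows "e \<bullet> hyperplane_reflection e l x = 2 * l - e \<bullet> x"
  using assms by (simp add: hyperplane_reflection_def inner_add_right norm_eq_1)

lemma hyperplane_reflection_involution:
  assumes "norm e = 1"
  shows "hyperplane_reflection e l (hyperplane_reflection e l x) = x"
proof -
  have "hyperplane_reflection e l (hyperplane_reflection e l x)
      = hyperplane_reflection e l x + (2 * (l - (2 * l - e \<bullet> x))) *\<^sub>R e"
    unfolding inner_hyperplane_reflection[OF assms, symmetric] by (simp only: hyperplane_reflection_def)
  also have "\<dots> = x + (2 * (l - e \<bullet> x) + 2 * (l - (2 * l - e \<bullet> x))) *\<^sub>R e"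
    unfolding hyperplane_reflection_def by (simp only: scaleR_add_left add.assoc)
  finally show ?thesis by simp
qed

lemma dist_hyperplane_reflection:
  assumes "norm e = 1"
  shows "dist (hyperplane_reflection e l x) (hyperplane_reflection e l y) = dist x y"
proof -
  have ee: "e \<bullet> e = 1" using assms by (simp add: norm_eq_1)
  define v where "v = x - y"
  have "hyperplane_reflection e l x - hyperplane_reflection e l y = v - (2 * (e \<bullet> v)) *\<^sub>R e"
    by (simp add: hyperplane_reflection_def v_def algebra_simps)
  moreover have "(norm (v - (2 * (e \<bullet> v)) *\<^sub>R e))\<^sup>2 = (norm v)\<^sup>2"
    by (simp add: power2_norm_eq_inner inner_diff_left inner_diff_right ee inner_commute)
  ultimately show ?thesis by (simp add: dist_norm v_def)
qed

text \<open>Only a lower bound for second differences of the bump is needed, so semiconvexity suffices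
  and no smoothness is required.\<close>

definition bump :: "'a::euclidean_space \<Rightarrow> real \<Rightarrow> 'a \<Rightarrow> real" where
  "bump x r y = max 0 (1 - (dist x y / r)\<^sup>2)"

lemma bump_bounds: "0 \<le> bump x r y" "bump x r y \<le> 1"
  by (simp_all add: bump_def)

lemma bump_outside: "0 < r \<Longrightarrow> r \<le> dist x y \<Longrightarrow> bump x r y = 0"
  by (simp add: bump_def max_def field_simps)

text \<open>The constant bound follows from the range of the bump. For the quadratic one, if the
  bump vanishes at \<open>z\<close> the second difference is nonnegative; otherwise the bump equals
  the paraboloid at \<open>z\<close> and lies above it at the other two points.\<close>

lemma bump_semiconvex:
  assumes r: "0 < r"
  shows "- 2 * min 1 ((dist z y / r)\<^sup>2) \<le> bump x r y + bump x r (2 *\<^sub>R z - y) - 2 * bump x r z"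
proof -
  have 1: "- 2 \<le> bump x r y + bump x r (2 *\<^sub>R z - y) - 2 * bump x r z"
    using bump_bounds[of x r y] bump_bounds[of x r "2 *\<^sub>R z - y"] bump_bounds[of x r z] by linarith
  have 2: "- 2 * (dist z y / r)\<^sup>2 \<le> bump x r y + bump x r (2 *\<^sub>R z - y) - 2 * bump x r z"
  proof (cases "bump x r z = 0")
    case True
    have "0 \<le> (dist z y / r)\<^sup>2" by simp
    then show ?thesis
      using True bump_bounds[of x r y] bump_bounds[of x r "2 *\<^sub>R z - y"] by linarith
  next
    case False
    then have bz: "bump x r z = 1 - (dist x z / r)\<^sup>2" by (simp add: bump_def max_def split: if_splits)
    have b1: "1 - (dist x y / r)\<^sup>2 \<le> bump x r y" by (simp add: bump_def)
    have b2: "1 - (dist x (2 *\<^sub>R z - y) / r)\<^sup>2 \<le> bump x r (2 *\<^sub>R z - y)" by (simp add: bump_def)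
    \<comment> \<open>Parallelogram law for \<open>z - x\<close> and \<open>y - z\<close>.\<close>
    have "(dist x y)\<^sup>2 + (dist x (2 *\<^sub>R z - y))\<^sup>2 = 2 * (dist x z)\<^sup>2 + 2 * (dist z y)\<^sup>2"
      by (simp add: dist_norm power2_norm_eq_inner inner_diff_left inner_diff_right inner_commute
          algebra_simps)
    then have "(dist x y / r)\<^sup>2 + (dist x (2 *\<^sub>R z - y) / r)\<^sup>2 = 2 * (dist x z / r)\<^sup>2 + 2 * (dist z y / r)\<^sup>2"
      by (simp add: power_divide add_divide_distrib[symmetric])
    then show ?thesis using bz b1 b2 by linarith
  qed
  show ?thesis using 1 2 by (simp add: min_def)
qed

section \<open>Bump error, mass of the half-space and folding along the hyperplane\<close>

context even_kernel begin

lemma bump_tail_integrable: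
  assumes \<epsilon>: "0 < \<epsilon>"
  shows "integrable lebesgue (\<lambda>y. indicator {y. \<epsilon> < dist z y} y * ((bump x r y - bump x r z) * k (y - z)))"
proof (rule Bochner_Integration.integrable_bound[OF k_tail_integrable[OF \<epsilon>]])
  have [measurable]: "bump x r \<in> borel_measurable lebesgue"
    unfolding bump_def[abs_def] by (rule measurable_completion) measurable
  show "(\<lambda>y. indicator {y. \<epsilon> < dist z y} y * ((bump x r y - bump x r z) * k (y - z))) \<in> borel_measurable lebesgue"
    by measurable
  show "AE y in lebesgue. norm (indicator {y. \<epsilon> < dist z y} y * ((bump x r y - bump x r z) * k (y - z)))
      \<le> norm (indicator {y. \<epsilon> < dist z y} y * k (y - z))"
  proof (rule AE_I2)
    fix y
    have "\<bar>bump x r y - bump x r z\<bar> \<le> 1"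
      using bump_bounds[of x r y] bump_bounds[of x r z] by linarith
    then have "\<bar>bump x r y - bump x r z\<bar> * k (y - z) \<le> 1 * k (y - z)"
      by (intro mult_right_mono k_nonneg)
    then show "norm (indicator {y. \<epsilon> < dist z y} y * ((bump x r y - bump x r z) * k (y - z)))
      \<le> norm (indicator {y. \<epsilon> < dist z y} y * k (y - z))"
      using k_nonneg by (simp add: abs_mult indicator_def)
  qed
qed

text \<open>Symmetrization halves the factor 2 of the semiconvexity bound. The result does not
  depend on \<open>\<epsilon>\<close>, so it survives the passage to the principal value.\<close>

lemma bump_tail_lower_bound:
  assumes \<epsilon>: "0 < \<epsilon>" and r: "0 < r"
  shows "- \<Lambda> * integral\<^sup>L lebesgue (trunc_power q z r)
    \<le> (\<integral>y. indicator {y. \<epsilon> < dist z y} y * ((bump x r y - bump x r z) * k (y - z)) \<partial>lebesgue)"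
proof -
  let ?T = "trunc_power q z r"
  note sym = central_symmetrization[OF bump_tail_integrable[OF \<epsilon>, of z x r]]
  have "(\<integral>y. (- 2 * \<Lambda>) * ?T y \<partial>lebesgue)
     \<le> (\<integral>y. indicator {y. \<epsilon> < dist z y} y *
       ((bump x r y + bump x r (2 *\<^sub>R z - y) - 2 * bump x r z) * k (y - z)) \<partial>lebesgue)"
  proof (rule integral_mono[OF _ sym(1)])
    show "integrable lebesgue (\<lambda>y. (- 2 * \<Lambda>) * ?T y)"
      by (intro integrable_mult_right trunc_power_integrable r)
    fix y
    let ?m = "min 1 ((dist z y / r)\<^sup>2)"
    have m0: "0 \<le> ?m" by simp
    have "?m * k (y - z) \<le> ?m * (\<Lambda> * dist z y powr (-q))"
      using k_shift_bound m0 by (rule mult_left_mono)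
    moreover have "- 2 * ?m * k (y - z) \<le> (bump x r y + bump x r (2 *\<^sub>R z - y) - 2 * bump x r z) * k (y - z)"
      using bump_semiconvex[OF r] k_nonneg by (rule mult_right_mono)
    ultimately have "(- 2 * \<Lambda>) * ?T y \<le> (bump x r y + bump x r (2 *\<^sub>R z - y) - 2 * bump x r z) * k (y - z)"
      by (simp only: mult.assoc mult.left_commute[of \<Lambda>])
    \<comment> \<open>Inside the removed ball the right-hand integrand is 0, so the sign of the left
      one is needed.\<close>
    moreover have "(- 2 * \<Lambda>) * ?T y \<le> 0"
      using m0 Lambda_nonneg by (simp add: mult_nonneg_nonneg)
    ultimately show "(- 2 * \<Lambda>) * ?T y \<le> indicator {y. \<epsilon> < dist z y} y *
       ((bump x r y + bump x r (2 *\<^sub>R z - y) - 2 * bump x r z) * k (y - z))"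
      by (cases "\<epsilon> < dist z y") simp_all
  qed
  then show ?thesis unfolding sym(2) by simp
qed

lemma half_space_integrable:
  assumes \<epsilon>: "0 < \<epsilon>" and far: "\<And>y. e \<bullet> y \<le> l \<Longrightarrow> \<epsilon> < dist z y"
  shows "integrable lebesgue (\<lambda>y. indicator {y. e \<bullet> y \<le> l} y * k (y - z))"
proof (rule Bochner_Integration.integrable_bound[OF k_tail_integrable[OF \<epsilon>]])
  have [measurable]: "{y. e \<bullet> y \<le> l} \<in> sets lebesgue"
    by (intro sets_completionI_sets) simp
  show "(\<lambda>y. indicator {y. e \<bullet> y \<le> l} y * k (y - z)) \<in> borel_measurable lebesgue"
    by measurable
  show "AE y in lebesgue. norm (indicator {y. e \<bullet> y \<le> l} y * k (y - z))
      \<le> norm (indicator {y. \<epsilon> < dist z y} y * k (y - z))"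
    using far k_nonneg by (intro AE_I2) (auto simp: indicator_def)
qed

text \<open>The half-space contains a ball of radius \<open>r\<close> all of whose points are within \<open>5 r\<close> of \<open>z\<close>.\<close>

lemma half_space_mass:
  assumes e: "norm e = 1" and l: "l \<le> e \<bullet> z" "e \<bullet> z - l \<le> 3 * r" and r: "0 < r"
    and \<kappa>: "0 \<le> \<kappa>" "\<And>h. \<kappa> * norm h powr (-q) \<le> k h"
    and int: "integrable lebesgue (\<lambda>y. indicator {y. e \<bullet> y \<le> l} y * k (y - z))"
  shows "\<kappa> * 5 powr (-q) * unit_ball_vol (real DIM('a)) * r powr (- 2 * s)
    \<le> (\<integral>y. indicator {y. e \<bullet> y \<le> l} y * k (y - z) \<partial>lebesgue)"
proof -
  define d where "d = e \<bullet> z - l"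
  \<comment> \<open>The centre lies at height \<open>l - r\<close> on the line through
    \<open>z\<close> in direction \<open>e\<close>, at distance \<open>d + r\<close>, hence at most
    \<open>4 * r\<close>, from \<open>z\<close>.\<close>
  define c where "c = z - (d + r) *\<^sub>R e"
  have d: "0 \<le> d" "d \<le> 3 * r" using l by (auto simp: d_def)
  have ee: "e \<bullet> e = 1" using e by (simp add: norm_eq_1)
  have ec: "e \<bullet> c = l - r" by (simp add: c_def d_def inner_diff_right ee)
  have "(\<integral>y. (\<kappa> * (5 * r) powr (-q)) * indicator (ball c r) y \<partial>lebesgue)
      \<le> (\<integral>y. indicator {y. e \<bullet> y \<le> l} y * k (y - z) \<partial>lebesgue)"
  proof (rule integral_mono[OF _ int])
    show "integrable lebesgue (\<lambda>y. (\<kappa> * (5 * r) powr (-q)) * indicator (ball c r) y)"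
      using lmeasurable_ball[of c r]
      by (intro integrable_mult_right integrable_real_indicator) (auto simp: fmeasurable_def)
    fix y
    show "(\<kappa> * (5 * r) powr (-q)) * indicator (ball c r) y \<le> indicator {y. e \<bullet> y \<le> l} y * k (y - z)"
    proof (cases "y \<in> ball c r")
      case True
      then have yc: "norm (y - c) < r" by (simp add: dist_norm norm_minus_commute)
      have "e \<bullet> (y - c) \<le> norm e * norm (y - c)" by (rule norm_cauchy_schwarz)
      then have ey: "e \<bullet> y < l" using yc e ec by (simp add: inner_diff_right)
      then have yz: "y \<noteq> z" using l by auto
      have "norm (y - z) \<le> norm (y - c) + norm (c - z)" by (rule norm_triangle_sub[of "y - z" "c - z", simplified, THEN order_trans]) simp
      also have "norm (c - z) = d + r" using d r e by (simp add: c_def)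
      finally have "norm (y - z) \<le> 5 * r" using yc d by linarith
      moreover have "0 \<le> q" using s q by simp
      ultimately have "(5 * r) powr (-q) \<le> norm (y - z) powr (-q)"
        using yz r by (intro powr_mono2') auto
      then have "\<kappa> * (5 * r) powr (-q) \<le> k (y - z)"
        using \<kappa>(2)[of "y - z"] mult_left_mono[OF _ \<kappa>(1)] by (meson order_trans)
      then show ?thesis using True ey by simp
    next
      case False
      then show ?thesis using k_nonneg by simp
    qed
  qed
  also have "(\<integral>y. (\<kappa> * (5 * r) powr (-q)) * indicator (ball c r) y \<partial>lebesgue)
      = \<kappa> * (5 * r) powr (-q) * (unit_ball_vol (real DIM('a)) * r ^ DIM('a))"
    using r by (simp add: content_ball)
  also have "\<dots> = \<kappa> * 5 powr (-q) * unit_ball_vol (real DIM('a)) * (r powr (-q) * r powr real DIM('a))"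
    using r by (simp add: powr_mult powr_realpow)
  also have "r powr (-q) * r powr real DIM('a) = r powr (- 2 * s)"
    by (simp add: powr_add[symmetric] q)
  finally show ?thesis .
qed

text \<open>On the half-space below \<open>l0\<close> the integrand is \<open>w + b\<close>, and the
  claim replaces it by \<open>b - a\<close>. The excess \<open>w + a\<close> may be negative at a
  mirror image \<open>R y\<close>, where it is \<open>a - w y\<close>; there the value at
  \<open>y\<close> compensates, since the kernel is at least as large at \<open>y\<close>.\<close>

lemma antisymmetric_lower_bound:
  fixes w \<psi> :: "'a \<Rightarrow> real" and e :: 'a and l :: real
  defines "R \<equiv> hyperplane_reflection e l"
  assumes e: "norm e = 1" and l: "l \<le> l0"
    and odd: "\<And>y. l < e \<bullet> y \<Longrightarrow> w (R y) = - w y"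
    and kR: "\<And>y. l < e \<bullet> y \<Longrightarrow> y \<noteq> z \<Longrightarrow> k (R y - z) \<le> k (y - z)"
    and \<psi>: "\<And>y. e \<bullet> y \<le> l0 \<Longrightarrow> \<psi> y = 0" "\<And>y. \<psi> y \<le> 1"
    and a: "0 \<le> a"
    and lower: "\<And>y. l < e \<bullet> y \<Longrightarrow> 0 \<le> w y - a * \<psi> y + b"
    and strip: "\<And>y. l < e \<bullet> y \<Longrightarrow> e \<bullet> y \<le> l0 \<Longrightarrow> 0 \<le> w y"
    and b: "0 \<le> b" and \<epsilon>: "0 < \<epsilon>"
    and ball: "\<And>y. dist z y \<le> \<epsilon> \<Longrightarrow> w y \<le> 0 \<and> l0 < e \<bullet> y"
    and int: "integrable lebesgue (\<lambda>y. indicator {y. \<epsilon> < dist z y} y * ((w y - a * \<psi> y + b) * k (y - z)))"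
  shows "(b - a) * (\<integral>y. indicator {y. e \<bullet> y \<le> l0} y * k (y - z) \<partial>lebesgue)
    \<le> (\<integral>y. indicator {y. \<epsilon> < dist z y} y * ((w y - a * \<psi> y + b) * k (y - z)) \<partial>lebesgue)"
proof -
  let ?D = "{y. \<epsilon> < dist z y}" and ?H = "{y. e \<bullet> y \<le> l0}"
  \<comment> \<open>\<open>Q\<close> itself changes sign; only its symmetrization under the reflection is nonnegative.\<close>
  define Q where "Q y = indicator ?D y * ((w y - a * \<psi> y + b) * k (y - z))
      - (b - a) * (indicator ?H y * k (y - z))" for y
  have far: "\<epsilon> < dist z y" if "e \<bullet> y \<le> l0" for y
    using ball[of y] that by force
  have intH: "integrable lebesgue (\<lambda>y. indicator ?H y * k (y - z))"
    using \<epsilon> far by (rule half_space_integrable)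
  have Qint: "integrable lebesgue Q"
    unfolding Q_def using int intH by (intro Bochner_Integration.integrable_diff integrable_mult_right)
  have iso: "dist (R x) (R y) = dist x y" and inv: "R (R x) = x" and eR: "e \<bullet> R x = 2 * l - e \<bullet> x" for x y
    unfolding R_def using e
    by (simp_all add: dist_hyperplane_reflection hyperplane_reflection_involution inner_hyperplane_reflection)
  have pos: "0 \<le> Q y + Q (R y)" if y: "l < e \<bullet> y" for y
  proof -
    have Ry: "e \<bullet> R y \<le> l0" using eR[of y] y l by linarith
    have QR: "Q (R y) = (a - w y) * k (R y - z)"
      using Ry far[OF Ry] odd[OF y] \<psi>(1)[OF Ry] by (simp add: Q_def algebra_simps)
    note k2 = k_nonneg[of "R y - z"]
    show ?thesis
    proof (cases "\<epsilon> < dist z y")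
      \<comment> \<open>In the removed ball \<open>Q y = 0\<close>, while \<open>w y \<le> 0\<close>
        makes the mirror term nonnegative.\<close>
      case False
      then have "w y \<le> 0" "l0 < e \<bullet> y" using ball[of y] by auto
      then show ?thesis
        using False a k2 unfolding QR by (simp add: Q_def)
    next
      case D: True
      then have "y \<noteq> z" using \<epsilon> by auto
      note k1 = kR[OF y this]
      show ?thesis
      proof (cases "e \<bullet> y \<le> l0")
        \<comment> \<open>In the strip between the hyperplane and \<open>l0\<close>, both
          \<open>y\<close> and \<open>R y\<close> lie in the half-space. Passing to the smaller
          kernel cancels \<open>w y\<close> and leaves \<open>2 * a\<close>.\<close>
        case True
        have wy: "0 \<le> w y" using strip[OF y True] .
        have "(w y + a) * k (R y - z) \<le> (w y + a) * k (y - z)"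
          using k1 wy a by (intro mult_left_mono) auto
        then have "2 * a * k (R y - z) \<le> (w y + a) * k (y - z) + (a - w y) * k (R y - z)"
          by (simp add: algebra_simps)
        moreover have "Q y = (w y + a) * k (y - z)"
          using D True \<psi>(1)[OF True] by (simp add: Q_def algebra_simps)
        moreover have "0 \<le> 2 * a * k (R y - z)" using a k2 by simp
        ultimately show ?thesis unfolding QR by linarith
      next
        \<comment> \<open>Above \<open>l0\<close>, \<open>lower\<close> allows passing to the
          smaller kernel; then \<open>w y\<close> cancels and \<open>b + (a - a * \<psi> y)\<close>
          remains.\<close>
        case False
        have Qy: "Q y = (w y - a * \<psi> y + b) * k (y - z)" using D False by (simp add: Q_def)
        have "(w y - a * \<psi> y + b) * k (R y - z) \<le> Q y"
          unfolding Qy using k1 lower[OF y] by (rule mult_left_mono)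
        moreover have "0 \<le> (b + (a - a * \<psi> y)) * k (R y - z)"
          using b k2 mult_left_mono[OF \<psi>(2)[of y] a] by simp
        ultimately show ?thesis unfolding QR by (simp add: algebra_simps)
      qed
    qed
  qed
  \<comment> \<open>Off the null hyperplane exactly one of \<open>y\<close> and \<open>R y\<close>
    lies strictly above it, and the sum is symmetric under exchanging them.\<close>
  have ae: "AE y in lebesgue. 0 \<le> Q y + Q (R y)"
  proof -
    have "e \<noteq> 0" using e by auto
    then have "negligible {y. e \<bullet> y = l}" by (intro negligible_hyperplane) auto
    then have "AE y in lebesgue. y \<notin> {y. e \<bullet> y = l}"
      by (intro AE_not_in) (simp add: negligible_iff_null_sets)
    then show ?thesis
    proof eventually_elim
      case (elim y)
      show ?case
      proof (cases "l < e \<bullet> y")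
        case False
        then have "l < e \<bullet> R y" using elim eR[of y] by auto
        from pos[OF this] show ?thesis by (simp add: inv)
      qed (rule pos)
    qed
  qed
  have "0 \<le> integral\<^sup>L lebesgue Q"
    unfolding integral_symmetrize(2)[OF iso inv Qint]
    using ae by (simp add: integral_nonneg_AE)
  also have "integral\<^sup>L lebesgue Q =
     (\<integral>y. indicator ?D y * ((w y - a * \<psi> y + b) * k (y - z)) \<partial>lebesgue)
      - (b - a) * (\<integral>y. indicator ?H y * k (y - z) \<partial>lebesgue)"
    unfolding Q_def using int intH by simp
  finally show ?thesis by simp
qed

text \<open>With this \<open>b\<close>, \<open>w y - w z\<close> is the sum of
  \<open>w y - a * bump x r y + b\<close> and \<open>a * (bump x r y - bump x r z)\<close>. Folding
  bounds the integral of the first summand, semiconvexity that of the second. Both bounds are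
  uniform in small \<open>\<epsilon>\<close>, so they pass to the limit.\<close>

lemma principal_value_lower_bound:
  fixes w :: "'a \<Rightarrow> real" and e :: 'a and l :: real
  defines "R \<equiv> hyperplane_reflection e l"
  assumes e: "norm e = 1" and l: "l \<le> l0"
    and w: "w \<in> Ls_space s"
    and odd: "\<And>y. l < e \<bullet> y \<Longrightarrow> w (R y) = - w y"
    and kR: "\<And>y. l < e \<bullet> y \<Longrightarrow> y \<noteq> z \<Longrightarrow> k (R y - z) \<le> k (y - z)"
    and r: "0 < r" "r \<le> e \<bullet> x - l0"
    and a: "0 \<le> a" and b: "0 \<le> b" "b = a * bump x r z - w z"
    and lower: "\<And>y. l < e \<bullet> y \<Longrightarrow> - b \<le> w y - a * bump x r y"
    and strip: "\<And>y. l < e \<bullet> y \<Longrightarrow> e \<bullet> y \<le> l0 \<Longrightarrow> 0 \<le> w y"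
    and \<delta>: "0 < \<delta>" "\<And>y. dist z y < \<delta> \<Longrightarrow> w y \<le> 0 \<and> l0 < e \<bullet> y"
    and J: "((\<lambda>\<epsilon>. set_lebesgue_integral lebesgue {y. \<epsilon> < dist z y}
      (\<lambda>y. (w y - w z) * k (y - z))) \<longlongrightarrow> J) (at_right 0)"
  shows "(b - a) * (\<integral>y. indicator {y. e \<bullet> y \<le> l0} y * k (y - z) \<partial>lebesgue)
      - a * \<Lambda> * integral\<^sup>L lebesgue (trunc_power q z r) \<le> J"
proof (rule tendsto_lowerbound[OF J])
  let ?D = "\<lambda>\<epsilon>. {y. \<epsilon> < dist z y}"
  have bump0: "bump x r y = 0" if "e \<bullet> y \<le> l0" for y
  proof (rule bump_outside)
    have "e \<bullet> (x - y) \<le> norm e * norm (x - y)" by (rule norm_cauchy_schwarz)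
    then show "r \<le> dist x y" using that r e by (simp add: inner_diff_right dist_norm)
  qed (rule r)
  have "(b - a) * (\<integral>y. indicator {y. e \<bullet> y \<le> l0} y * k (y - z) \<partial>lebesgue)
      - a * \<Lambda> * integral\<^sup>L lebesgue (trunc_power q z r)
      \<le> set_lebesgue_integral lebesgue (?D \<epsilon>) (\<lambda>y. (w y - w z) * k (y - z))"
    if \<epsilon>: "0 < \<epsilon>" "\<epsilon> < \<delta>" for \<epsilon>
  proof -
    let ?P = "\<lambda>y. indicator (?D \<epsilon>) y * ((w y - a * bump x r y + b) * k (y - z))"
    let ?W = "\<lambda>y. indicator (?D \<epsilon>) y * ((w y - w z) * k (y - z))"
    let ?B = "\<lambda>y. indicator (?D \<epsilon>) y * ((bump x r y - bump x r z) * k (y - z))"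
    have eq: "?P y = ?W y - a * ?B y" for y
      unfolding b(2) by (simp add: algebra_simps)
    have intW: "integrable lebesgue ?W" using w \<epsilon>(1) by (rule Ls_difference_tail_integrable)
    have intB: "integrable lebesgue ?B" using \<epsilon>(1) by (rule bump_tail_integrable)
    have intP: "integrable lebesgue ?P"
      unfolding eq using intW intB by (intro Bochner_Integration.integrable_diff integrable_mult_right)
    have "(b - a) * (\<integral>y. indicator {y. e \<bullet> y \<le> l0} y * k (y - z) \<partial>lebesgue) \<le> integral\<^sup>L lebesgue ?P"
    proof (rule antisymmetric_lower_bound[OF e l])
      show "w y \<le> 0 \<and> l0 < e \<bullet> y" if "dist z y \<le> \<epsilon>" for y
        using \<delta>(2)[of y] that \<epsilon> by simp
      show "0 \<le> w y - a * bump x r y + b" if "l < e \<bullet> y" for y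
        using lower[OF that] by linarith
    qed (use odd kR bump0 bump_bounds a strip b(1) \<epsilon> intP in \<open>auto simp: R_def\<close>)
    also have "integral\<^sup>L lebesgue ?P = integral\<^sup>L lebesgue ?W - a * integral\<^sup>L lebesgue ?B"
      unfolding eq using intW intB by simp
    finally have "(b - a) * (\<integral>y. indicator {y. e \<bullet> y \<le> l0} y * k (y - z) \<partial>lebesgue)
       + a * integral\<^sup>L lebesgue ?B \<le> integral\<^sup>L lebesgue ?W" by simp
    moreover have "a * (- \<Lambda> * integral\<^sup>L lebesgue (trunc_power q z r)) \<le> a * integral\<^sup>L lebesgue ?B"
      using bump_tail_lower_bound[OF \<epsilon>(1) r(1)] a by (rule mult_left_mono)
    ultimately show ?thesis by (simp add: set_lebesgue_integral_def)
  qed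
  then show "\<forall>\<^sub>F \<epsilon> in at_right 0. (b - a) * (\<integral>y. indicator {y. e \<bullet> y \<le> l0} y * k (y - z) \<partial>lebesgue)
      - a * \<Lambda> * integral\<^sup>L lebesgue (trunc_power q z r)
      \<le> set_lebesgue_integral lebesgue (?D \<epsilon>) (\<lambda>y. (w y - w z) * k (y - z))"
    using \<delta>(1) unfolding eventually_at_right_field by blast
qed simp

end

subsection \<open>Semicontinuity, second differences and admissible matrices\<close>

lemma lower_semicontinuous_on_subset:
  "lower_semicontinuous_on S f \<Longrightarrow> T \<subseteq> S \<Longrightarrow> lower_semicontinuous_on T f"
  unfolding lower_semicontinuous_on_def
  by (meson at_le filter_leD subsetD)

lemma lower_semicontinuous_on_diff_continuous:
  fixes f g :: "'a::topological_space \<Rightarrow> real"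
  assumes f: "lower_semicontinuous_on S f" and g: "continuous_on S g"
  shows "lower_semicontinuous_on S (\<lambda>x. f x - g x)"
  unfolding lower_semicontinuous_on_def
proof (intro ballI allI impI)
  fix x c assume x: "x \<in> S" and c: "c < f x - g x"
  define d where "d = (f x - g x - c) / 2"
  have d: "d > 0" using c by (simp add: d_def)
  have "\<forall>\<^sub>F y in at x within S. f x - d < f y"
    using f x d unfolding lower_semicontinuous_on_def by simp
  moreover have "\<forall>\<^sub>F y in at x within S. g y < g x + d"
    using g x d by (intro order_tendstoD(2)) (auto simp: continuous_on_def)
  ultimately show "\<forall>\<^sub>F y in at x within S. c < f y - g y"
    by eventually_elim (simp add: d_def field_simps)
qed

text \<open>If no minimum existed, each \<open>z\<close> would have some \<open>h z\<close> with a
  smaller value, and \<open>f > f (h z)\<close> on a neighbourhood of \<open>z\<close>. In a finite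
  subcover, the point \<open>h p\<close> with the least value lies in some \<open>U z\<close>, which
  gives the smaller value \<open>f (h z)\<close>.\<close>

lemma lower_semicontinuous_attains_inf:
  fixes f :: "'a::topological_space \<Rightarrow> real"
  assumes S: "compact S" "S \<noteq> {}" and f: "lower_semicontinuous_on S f"
  obtains z where "z \<in> S" "\<And>y. y \<in> S \<Longrightarrow> f z \<le> f y"
proof (rule ccontr)
  assume "\<not> thesis"
  then have "\<forall>z\<in>S. \<exists>y\<in>S. f y < f z" using that by (meson not_le)
  then obtain h where h: "\<And>z. z \<in> S \<Longrightarrow> h z \<in> S" "\<And>z. z \<in> S \<Longrightarrow> f (h z) < f z"
    by metis
  have "\<exists>U. open U \<and> z \<in> U \<and> (\<forall>y\<in>U \<inter> S. f (h z) < f y)" if z: "z \<in> S" for z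
  proof -
    have "\<forall>\<^sub>F y in at z within S. f (h z) < f y"
      using f z h(2)[OF z] unfolding lower_semicontinuous_on_def by blast
    then obtain U where "open U" "z \<in> U" "\<forall>y\<in>U. y \<noteq> z \<longrightarrow> y \<in> S \<longrightarrow> f (h z) < f y"
      unfolding eventually_at_topological by blast
    then show ?thesis using h(2)[OF z] by (metis IntE)
  qed
  then obtain U where U: "\<And>z. z \<in> S \<Longrightarrow> open (U z)" "\<And>z. z \<in> S \<Longrightarrow> z \<in> U z"
    "\<And>z y. z \<in> S \<Longrightarrow> y \<in> U z \<Longrightarrow> y \<in> S \<Longrightarrow> f (h z) < f y"
    by (metis IntI)
  from S(1) obtain D where D: "D \<subseteq> S" "finite D" "S \<subseteq> (\<Union>z\<in>D. U z)"
    by (rule compactE_image[of S S U]) (use U in auto)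
  have "D \<noteq> {}" using D S by auto
  then obtain p where p: "p \<in> D" "\<And>z. z \<in> D \<Longrightarrow> f (h p) \<le> f (h z)"
    using ex_min_if_finite[of "(\<lambda>z. f (h z)) ` D"] D(2) by (force simp: not_less)
  have "h p \<in> S" using p D h by auto
  then obtain z where "z \<in> D" "h p \<in> U z" using D by auto
  then have "f (h z) < f (h p)" using U(3) D \<open>h p \<in> S\<close> by auto
  then show False using p(2)[OF \<open>z \<in> D\<close>] by simp
qed

text \<open>The mean value theorem for \<open>w (z + t *\<^sub>R h) + w (z - t *\<^sub>R h)\<close>
  on the unit interval expresses the second difference by two gradients at distance at most
  \<open>2 * norm h\<close>; hence the constant \<open>2 * L\<close>.\<close>

lemma C11_loc_second_difference:
  fixes w :: "'a::euclidean_space \<Rightarrow> real"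
  assumes w: "w \<in> C11_loc \<Omega>" and z: "z \<in> \<Omega>"
  obtains r L where "0 < r" "0 \<le> L"
    "\<And>h. norm h < r \<Longrightarrow> \<bar>w (z + h) + w (z - h) - 2 * w z\<bar> \<le> L * (norm h)\<^sup>2"
proof -
  obtain g where g: "\<And>x. x \<in> \<Omega> \<Longrightarrow> GDERIV w x :> g x"
    and lip: "\<forall>x\<in>\<Omega>. \<exists>r>0. \<exists>L. ball x r \<subseteq> \<Omega> \<and> L-lipschitz_on (ball x r) g"
    using w unfolding C11_loc_def by blast
  obtain r L where r: "0 < r" "ball z r \<subseteq> \<Omega>" and L: "L-lipschitz_on (ball z r) g"
    using lip z by blast
  have L0: "0 \<le> L" using L by (rule lipschitz_on_nonneg)
  have "\<bar>w (z + h) + w (z - h) - 2 * w z\<bar> \<le> (2 * L) * (norm h)\<^sup>2" if h: "norm h < r" for h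
  proof -
    have seg: "z + t *\<^sub>R h \<in> ball z r" "z - t *\<^sub>R h \<in> ball z r" if "0 \<le> t" "t \<le> 1" for t
    proof -
      have "\<bar>t\<bar> * norm h \<le> 1 * norm h" using that by (intro mult_right_mono) auto
      then show "z + t *\<^sub>R h \<in> ball z r" "z - t *\<^sub>R h \<in> ball z r"
        using h by (auto simp: dist_norm)
    qed
    let ?\<phi> = "\<lambda>t::real. w (z + t *\<^sub>R h) + w (z - t *\<^sub>R h)"
    have "\<exists>t\<in>{0<..<1}. ?\<phi> 1 - ?\<phi> 0
        = (\<lambda>u. (u *\<^sub>R h) \<bullet> g (z + t *\<^sub>R h) + (- (u *\<^sub>R h)) \<bullet> g (z - t *\<^sub>R h)) (1 - 0)"
    proof (rule mvt_simple)
      fix t :: real assume t: "0 \<le> t" "t \<le> 1"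
      have "z + t *\<^sub>R h \<in> \<Omega>" "z - t *\<^sub>R h \<in> \<Omega>" using seg[OF t] r by blast+
      note g' = this[THEN g, unfolded gderiv_def]
      have d1: "(w has_derivative (\<lambda>v. v \<bullet> g (z + t *\<^sub>R h))) (at (z + t *\<^sub>R h))"
        and d2: "(w has_derivative (\<lambda>v. v \<bullet> g (z - t *\<^sub>R h))) (at (z - t *\<^sub>R h))"
        using g' by simp_all
      have e1: "((\<lambda>t. z + t *\<^sub>R h) has_derivative (\<lambda>u. u *\<^sub>R h)) (at t within {0..1})"
        and e2: "((\<lambda>t. z - t *\<^sub>R h) has_derivative (\<lambda>u. - (u *\<^sub>R h))) (at t within {0..1})"
        by (auto intro!: derivative_eq_intros)
      show "(?\<phi> has_derivative (\<lambda>u. (u *\<^sub>R h) \<bullet> g (z + t *\<^sub>R h) + (- (u *\<^sub>R h)) \<bullet> g (z - t *\<^sub>R h)))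
          (at t within {0..1})"
        by (intro has_derivative_add has_derivative_compose[OF e1 d1] has_derivative_compose[OF e2 d2])
    qed simp
    then obtain t where t: "0 < t" "t < 1"
      and eq: "w (z + h) + w (z - h) - 2 * w z = h \<bullet> (g (z + t *\<^sub>R h) - g (z - t *\<^sub>R h))"
      by (auto simp: inner_diff_right)
    have "dist (g (z + t *\<^sub>R h)) (g (z - t *\<^sub>R h)) \<le> L * dist (z + t *\<^sub>R h) (z - t *\<^sub>R h)"
      using L seg[of t] t by (intro lipschitz_onD) auto
    also have "dist (z + t *\<^sub>R h) (z - t *\<^sub>R h) = 2 * t * norm h"
    proof -
      have "(z + t *\<^sub>R h) - (z - t *\<^sub>R h) = (2 * t) *\<^sub>R h"
        by (simp add: algebra_simps scaleR_2[symmetric])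
      then show ?thesis using t by (simp add: dist_norm)
    qed
    also have "L * (2 * t * norm h) \<le> L * (2 * 1 * norm h)"
      using t L0 by (intro mult_left_mono mult_right_mono) auto
    finally have "norm (g (z + t *\<^sub>R h) - g (z - t *\<^sub>R h)) \<le> L * (2 * norm h)"
      by (simp add: dist_norm)
    then have "norm h * norm (g (z + t *\<^sub>R h) - g (z - t *\<^sub>R h)) \<le> norm h * (L * (2 * norm h))"
      by (intro mult_left_mono) auto
    moreover have "\<bar>h \<bullet> (g (z + t *\<^sub>R h) - g (z - t *\<^sub>R h))\<bar>
        \<le> norm h * norm (g (z + t *\<^sub>R h) - g (z - t *\<^sub>R h))"
      by (rule Cauchy_Schwarz_ineq2)
    ultimately show ?thesis unfolding eq by (simp add: power2_eq_square mult_ac)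
  qed
  then show ?thesis using that[of r "2 * L"] r L0 by simp
qed

section \<open>Admissible matrices and their kernels\<close>

lemma symmetric_matrix_inner:
  fixes A :: "real^'n^'n"
  assumes "transpose A = A"
  shows "(A *v x) \<bullet> y = x \<bullet> (A *v y)"
  using assms by (metis dot_lmul_matrix transpose_matrix_vector)

context
  fixes \<theta> \<Theta> :: real and e :: "real^'n" and A :: "real^'n^'n"
  assumes A: "A \<in> admissible \<theta> \<Theta> e" and \<theta>: "0 < \<theta>"
begin

lemma admissible_symmetric: "(A *v x) \<bullet> y = x \<bullet> (A *v y)"
  using A by (intro symmetric_matrix_inner) (simp add: admissible_def)

lemma admissible_lower: "\<theta> * (v \<bullet> v) \<le> v \<bullet> (A *v v)"
  and admissible_upper: "v \<bullet> (A *v v) \<le> \<Theta> * (v \<bullet> v)"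
  using A by (auto simp: admissible_def)

lemma admissible_inverse: "A *v (matrix_inv A *v h) = h" "matrix_inv A *v (A *v h) = h"
proof -
  have "x = y" if eq: "A *v x = A *v y" for x y
  proof -
    have "A *v (x - y) = 0" using eq by (simp add: matrix_vector_mult_diff_distrib)
    then have "\<theta> * ((x - y) \<bullet> (x - y)) \<le> 0" using admissible_lower[of "x - y"] by simp
    then have "(x - y) \<bullet> (x - y) \<le> 0" using \<theta> by (simp add: mult_le_0_iff)
    then show ?thesis by (metis inner_gt_zero_iff not_le right_minus_eq)
  qed
  then have "inj ((*v) A)" by (rule injI)
  then have "invertible A"
    using invertible_left_inverse matrix_left_invertible_injective by blast
  then have "A ** matrix_inv A = mat 1 \<and> matrix_inv A ** A = mat 1"
    unfolding invertible_def matrix_inv_def by (rule someI_ex)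
  then show "A *v (matrix_inv A *v h) = h" "matrix_inv A *v (A *v h) = h"
    by (simp_all add: matrix_vector_mul_assoc)
qed

lemma admissible_inverse_upper: "norm (matrix_inv A *v h) \<le> norm h / \<theta>"
proof -
  let ?g = "matrix_inv A *v h"
  have "\<theta> * (norm ?g)\<^sup>2 \<le> ?g \<bullet> h"
    using admissible_lower[of ?g] by (simp add: admissible_inverse power2_norm_eq_inner)
  also have "\<dots> \<le> norm ?g * norm h" by (rule norm_cauchy_schwarz)
  finally have "norm ?g * (\<theta> * norm ?g) \<le> norm ?g * norm h"
    by (simp add: power2_eq_square mult_ac)
  then have "\<theta> * norm ?g \<le> norm h"
    by (cases "norm ?g = 0") (simp_all)
  then show ?thesis using \<theta> by (simp add: field_simps)
qed

text \<open>The form bound becomes an operator norm bound without diagonalization: positivity of the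
  form of \<open>A\<close> at \<open>\<Theta> *\<^sub>R g - A *v g\<close>, with the upper form
  bound at \<open>A *v g\<close>, shows that the squared norm of \<open>A *v g\<close> is at most
  \<open>\<Theta> * (g \<bullet> (A *v g))\<close>.\<close>

lemma admissible_norm_le:
  assumes \<Theta>: "0 < \<Theta>"
  shows "norm (A *v g) \<le> \<Theta> * norm g"
proof -
  let ?p = "A *v g"
  have "0 \<le> (\<Theta> *\<^sub>R g - ?p) \<bullet> (A *v (\<Theta> *\<^sub>R g - ?p))"
    using admissible_lower[of "\<Theta> *\<^sub>R g - ?p"] \<theta> by (meson inner_ge_zero mult_nonneg_nonneg less_imp_le order_trans)
  also have "A *v (\<Theta> *\<^sub>R g - ?p) = \<Theta> *\<^sub>R ?p - A *v ?p"
    by (simp add: matrix_vector_mult_diff_distrib matrix_vector_mult_scaleR)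
  also have "(\<Theta> *\<^sub>R g - ?p) \<bullet> (\<Theta> *\<^sub>R ?p - A *v ?p)
      = \<Theta> * \<Theta> * (g \<bullet> ?p) - \<Theta> * (g \<bullet> (A *v ?p)) - \<Theta> * (?p \<bullet> ?p) + ?p \<bullet> (A *v ?p)"
    by (simp add: inner_diff_left inner_diff_right right_diff_distrib)
  also have "g \<bullet> (A *v ?p) = ?p \<bullet> ?p" by (simp add: admissible_symmetric)
  finally have "0 \<le> \<Theta> * \<Theta> * (g \<bullet> ?p) - 2 * \<Theta> * (?p \<bullet> ?p) + \<Theta> * (?p \<bullet> ?p)"
    using admissible_upper[of ?p] by linarith
  then have "\<Theta> * (?p \<bullet> ?p) \<le> \<Theta> * (\<Theta> * (g \<bullet> ?p))" by (simp add: algebra_simps)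
  then have "?p \<bullet> ?p \<le> \<Theta> * (g \<bullet> ?p)" using \<Theta> by simp
  also have "\<dots> \<le> \<Theta> * (norm g * norm ?p)"
    using \<Theta> by (intro mult_left_mono norm_cauchy_schwarz) auto
  finally have "norm ?p * norm ?p \<le> norm ?p * (\<Theta> * norm g)"
    by (simp add: power2_norm_eq_inner[symmetric] power2_eq_square mult_ac)
  then show ?thesis using \<Theta> by (cases "norm ?p = 0") simp_all
qed

text \<open>This is where the eigenvector condition enters. Reflecting \<open>y\<close> moves its
  image under the inverse along \<open>e\<close> only, and by symmetry the
  \<open>e\<close>-component of that image depends only on \<open>e \<bullet> (y - z)\<close>. The
  squared norms then differ by
  \<open>4 * (l - e \<bullet> y) * (l - e \<bullet> z) / \<mu>^2\<close>, nonnegative as both points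
  lie on the same side.\<close>

lemma admissible_inverse_reflection:
  assumes e: "norm e = 1" and z: "l < e \<bullet> z" and y: "l < e \<bullet> y"
  shows "norm (matrix_inv A *v (y - z)) \<le> norm (matrix_inv A *v (hyperplane_reflection e l y - z))"
proof -
  obtain \<mu> where \<mu>: "A *v e = \<mu> *\<^sub>R e" using A by (auto simp: admissible_def)
  have ee: "e \<bullet> e = 1" using e by (simp add: norm_eq_1)
  have \<mu>0: "\<mu> > 0" using admissible_lower[of e] \<theta> by (simp add: \<mu> ee)
  let ?B = "matrix_inv A"
  define t where "t = 2 * (l - e \<bullet> y)"
  define g where "g = ?B *v (y - z)"
  have Be: "?B *v e = (1 / \<mu>) *\<^sub>R e"
  proof -
    have "?B *v (A *v e) = e" by (rule admissible_inverse)
    then have "\<mu> *\<^sub>R (?B *v e) = e" by (simp add: \<mu> matrix_vector_mult_scaleR)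
    then have "(1 / \<mu>) *\<^sub>R (\<mu> *\<^sub>R (?B *v e)) = (1 / \<mu>) *\<^sub>R e" by simp
    then show ?thesis using \<mu>0 by simp
  qed
  have ge: "e \<bullet> g = (e \<bullet> (y - z)) / \<mu>"
  proof -
    have "(A *v e) \<bullet> g = e \<bullet> (A *v g)" by (rule admissible_symmetric)
    then have "\<mu> * (e \<bullet> g) = e \<bullet> (y - z)" by (simp add: \<mu> g_def admissible_inverse)
    then show ?thesis using \<mu>0 by (simp add: field_simps)
  qed
  have "?B *v (hyperplane_reflection e l y - z) = g + (t / \<mu>) *\<^sub>R e"
  proof -
    have eq: "hyperplane_reflection e l y - z = (y - z) + t *\<^sub>R e"
      by (simp add: hyperplane_reflection_def t_def)
    show ?thesis
      unfolding eq g_def matrix_vector_right_distrib by (simp add: matrix_vector_mult_scaleR Be)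
  qed
  note refl = this
  have "(norm (g + (t / \<mu>) *\<^sub>R e))\<^sup>2 = (norm g)\<^sup>2 + 2 * (t / \<mu>) * (e \<bullet> g) + (t / \<mu>)\<^sup>2"
    unfolding power2_norm_eq_inner
    by (simp add: inner_add_left inner_add_right ee inner_commute power2_eq_square)
  moreover have "2 * (t / \<mu>) * (e \<bullet> g) + (t / \<mu>)\<^sup>2 = 4 * ((l - e \<bullet> y) * (l - e \<bullet> z)) / \<mu>\<^sup>2"
    using \<mu>0 unfolding ge t_def by (simp add: field_simps power2_eq_square inner_diff_right)
  moreover have "0 \<le> 4 * ((l - e \<bullet> y) * (l - e \<bullet> z)) / \<mu>\<^sup>2"
    using z y by (intro divide_nonneg_nonneg mult_nonneg_nonneg mult_nonpos_nonpos) auto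
  ultimately have "(norm g)\<^sup>2 \<le> (norm (g + (t / \<mu>) *\<^sub>R e))\<^sup>2"
    by linarith
  then show ?thesis unfolding refl g_def[symmetric] by (rule power2_le_imp_le) simp
qed

text \<open>The norm of \<open>matrix_inv A *v h\<close> lies between
  \<open>norm h / \<Theta>\<close> and \<open>norm h / \<theta>\<close>, and the negative exponent
  reverses these bounds. At \<open>h = 0\<close> everything is 0 by the convention for
  \<open>0 powr (-q)\<close>.\<close>

lemma admissible_kernel:
  fixes s :: real
  assumes n: "CARD('n) \<ge> 2" and s: "0 < s" "s < 1" and \<Theta>: "0 < \<Theta>"
  defines "q \<equiv> real CARD('n) + 2 * s"
  shows "even_kernel (\<lambda>h. norm (matrix_inv A *v h) powr (-q)) s (\<Theta> powr q) q"
    and "\<theta> powr q * norm h powr (-q) \<le> norm (matrix_inv A *v h) powr (-q)"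
proof -
  have q0: "0 \<le> q" using s by (simp add: q_def)
  have zero: "matrix_inv A *v h = 0 \<longleftrightarrow> h = 0" for h
    using admissible_inverse(1)[of h] by auto
  have powr_quot: "c powr q * t powr (-q) = (t / c) powr (-q)" if "0 < c" "0 \<le> t" for c t :: real
    using that by (simp add: powr_divide powr_minus field_simps)
  show "even_kernel (\<lambda>h. norm (matrix_inv A *v h) powr (-q)) s (\<Theta> powr q) q"
  proof
    show "2 \<le> DIM(real^'n)" using n by simp
    show "q = real DIM(real^'n) + 2 * s" by (simp add: q_def)
    have "continuous_on UNIV ((*v) (matrix_inv A))"
      by (intro linear_continuous_on linear_conv_bounded_linear[THEN iffD1] matrix_vector_mul_linear)
    then have [measurable]: "(*v) (matrix_inv A) \<in> borel_measurable borel"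
      by (rule borel_measurable_continuous_onI)
    show "(\<lambda>h. norm (matrix_inv A *v h) powr (-q)) \<in> borel_measurable borel" by measurable
    show "norm (matrix_inv A *v - h) powr (-q) = norm (matrix_inv A *v h) powr (-q)" for h
      using matrix_vector_mult_scaleR[of "matrix_inv A" "-1" h] by simp
    show "norm (matrix_inv A *v h) powr (-q) \<le> \<Theta> powr q * norm h powr (-q)" for h
    proof (cases "h = 0")
      case False
      have "norm h \<le> \<Theta> * norm (matrix_inv A *v h)"
        using admissible_norm_le[OF \<Theta>, of "matrix_inv A *v h"] by (simp add: admissible_inverse)
      then have "norm h / \<Theta> \<le> norm (matrix_inv A *v h)" using \<Theta> by (simp add: field_simps)
      then have "norm (matrix_inv A *v h) powr (-q) \<le> (norm h / \<Theta>) powr (-q)"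
        using False \<Theta> q0 by (intro powr_mono2') auto
      then show ?thesis using powr_quot[OF \<Theta>, of "norm h"] by simp
    qed simp
  qed (use s in auto)
  show "\<theta> powr q * norm h powr (-q) \<le> norm (matrix_inv A *v h) powr (-q)"
  proof (cases "h = 0")
    case False
    have "(norm h / \<theta>) powr (-q) \<le> norm (matrix_inv A *v h) powr (-q)"
      using False admissible_inverse_upper[of h] q0 zero by (intro powr_mono2') auto
    then show ?thesis using powr_quot[OF \<theta>, of "norm h"] by simp
  qed simp
qed

end

text \<open>Ensures that the \<open>INF\<close> in \<open>Fs\<close> ranges over a nonempty set, so
  that a uniform lower bound passes to it.\<close>

lemma admissible_nonempty:
  fixes e :: "real^'n"
  assumes "e \<noteq> 0" "\<theta> \<le> \<Theta>"
  shows "\<theta> *\<^sub>R mat 1 \<in> admissible \<theta> \<Theta> e"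
proof -
  have "(\<theta> *\<^sub>R mat 1 :: real^'n^'n) *v v = \<theta> *\<^sub>R v" for v
    by (simp add: scaleR_matrix_vector_assoc[symmetric])
  then show ?thesis
    using assms by (auto simp: admissible_def transpose_scalar mult_right_mono)
qed

subsection \<open>The extremal operator at a perturbed minimum\<close>

text \<open>For every admissible \<open>A\<close> the half-space mass gives the gain and the bump
  the loss, both of order \<open>r powr (- 2 * s)\<close> with constants independent of
  \<open>A\<close>. The gain constant involves \<open>\<theta>\<close> but not
  \<open>\<Theta>\<close>, which appears only in the loss.\<close>

lemma Fs_lower_bound:
  fixes w :: "real^'n \<Rightarrow> real" and e :: "real^'n" and s l :: real
  defines "q \<equiv> real CARD('n) + 2 * s"
  assumes n: "CARD('n) \<ge> 2" and s: "0 < s" "s < 1" and \<theta>: "0 < \<theta>" "\<theta> \<le> \<Theta>"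
    and e: "norm e = 1" and l: "l \<le> l0"
    and w: "w \<in> Ls_space s" "w \<in> C11_loc \<Omega>" and z: "z \<in> \<Omega>" "w z < 0" "dist x z < r"
    and odd: "\<And>y. l < e \<bullet> y \<Longrightarrow> w (hyperplane_reflection e l y) = - w y"
    and r: "0 < r" "2 * r = e \<bullet> x - l0"
    and a: "0 \<le> a" "a \<le> b" and b: "b = a * bump x r z - w z"
    and lower: "\<And>y. l < e \<bullet> y \<Longrightarrow> - b \<le> w y - a * bump x r y"
    and strip: "\<And>y. l < e \<bullet> y \<Longrightarrow> e \<bullet> y \<le> l0 \<Longrightarrow> 0 \<le> w y"
    and C: "integral\<^sup>L lebesgue (trunc_power q z r) \<le> C * r powr (- 2 * s)"
  shows "((b - a) * (\<theta> powr q * 5 powr (-q) * unit_ball_vol (real CARD('n))) - a * (\<Theta> powr q * C))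
      * r powr (- 2 * s) \<le> Fs s \<theta> \<Theta> e w z"
proof -
  \<comment> \<open>The point \<open>x\<close> has height \<open>l0 + 2 * r\<close> and
    \<open>z\<close> is within \<open>r\<close> of it. The lower bound keeps \<open>z\<close> away
    from the half-space, the upper one is needed for its mass.\<close>
  have ez: "l0 + r < e \<bullet> z" "e \<bullet> z \<le> l0 + 3 * r"
  proof -
    have "\<bar>e \<bullet> (x - z)\<bar> \<le> norm e * norm (x - z)" by (rule Cauchy_Schwarz_ineq2)
    then have "\<bar>e \<bullet> x - e \<bullet> z\<bar> < r" using e z(3) by (simp add: inner_diff_right dist_norm)
    then show "l0 + r < e \<bullet> z" "e \<bullet> z \<le> l0 + 3 * r" using r(2) by linarith+
  qed
  obtain \<rho> L where \<rho>: "0 < \<rho>" and L: "0 \<le> L"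
    and second: "\<And>h. norm h < \<rho> \<Longrightarrow> \<bar>w (z + h) + w (z - h) - 2 * w z\<bar> \<le> L * (norm h)\<^sup>2"
    using C11_loc_second_difference[OF w(2) z(1)] by blast
  \<comment> \<open>Continuity keeps \<open>w\<close> negative near \<open>z\<close>; the radius
    \<open>r\<close> keeps the ball above height \<open>l0\<close>.\<close>
  obtain \<delta> where \<delta>: "0 < \<delta>" "\<And>y. dist z y < \<delta> \<Longrightarrow> w y \<le> 0 \<and> l0 < e \<bullet> y"
  proof -
    obtain g where "GDERIV w z :> g" using w(2) z(1) by (auto simp: C11_loc_def)
    then have "isCont w z" unfolding gderiv_def by (rule has_derivative_continuous)
    then obtain d where d: "0 < d" "\<And>y. dist y z < d \<Longrightarrow> dist (w y) (w z) < - w z"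
      using z(2) unfolding continuous_at_eps_delta by (metis neg_0_less_iff_less)
    show ?thesis
    proof
      show "0 < min d r" using d r by simp
      fix y assume y: "dist z y < min d r"
      have "\<bar>e \<bullet> (z - y)\<bar> \<le> norm e * norm (z - y)" by (rule Cauchy_Schwarz_ineq2)
      then have "\<bar>e \<bullet> z - e \<bullet> y\<bar> < r" using e y by (simp add: inner_diff_right dist_norm)
      moreover have "\<bar>w y - w z\<bar> < - w z" using d(2)[of y] y by (simp add: dist_commute dist_real_def)
      ultimately show "w y \<le> 0 \<and> l0 < e \<bullet> y" using ez by linarith
    qed
  qed
  have b0: "0 \<le> b" using a by simp
  show ?thesis
    unfolding Fs_def
  proof (rule cINF_greatest)
    have "e \<noteq> 0" using e by auto
    then show "admissible \<theta> \<Theta> e \<noteq> {}" using admissible_nonempty \<theta>(2) by blast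
  next
    fix A assume A: "A \<in> admissible \<theta> \<Theta> e"
    define k where "k h = norm (matrix_inv A *v h) powr (-q)" for h
    have \<Theta>: "0 < \<Theta>" using \<theta> by simp
    interpret even_kernel k s "\<Theta> powr q" q
      unfolding k_def[abs_def] q_def using admissible_kernel(1)[OF A \<theta>(1) n s \<Theta>] by simp
    have klow: "\<theta> powr q * norm h powr (-q) \<le> k h" for h
      unfolding k_def q_def using admissible_kernel(2)[OF A \<theta>(1) n s \<Theta>] by simp
    have k_eq: "(w y - w z) / norm (matrix_inv A *v (y - z)) powr (real CARD('n) + 2 * s)
        = (w y - w z) * k (y - z)" for y
      by (simp add: k_def q_def[symmetric] powr_minus divide_inverse)
    obtain J where J: "((\<lambda>\<epsilon>. set_lebesgue_integral lebesgue {y. \<epsilon> < dist z y}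
      (\<lambda>y. (w y - w z) * k (y - z))) \<longlongrightarrow> J) (at_right 0)"
      using principal_value_converges[OF w(1) \<rho> L second] by blast
    then have pv: "pv_integral z (\<lambda>y. (w y - w z) * k (y - z)) = J"
      unfolding pv_integral_def by (intro tendsto_Lim) simp_all
    let ?I = "\<integral>y. indicator {y. e \<bullet> y \<le> l0} y * k (y - z) \<partial>lebesgue"
    have I: "\<theta> powr q * 5 powr (-q) * unit_ball_vol (real CARD('n)) * r powr (- 2 * s) \<le> ?I"
    proof -
      have "integrable lebesgue (\<lambda>y. indicator {y. e \<bullet> y \<le> l0} y * k (y - z))"
      proof (rule half_space_integrable)
        show "0 < \<delta> / 2" using \<delta> by simp
        show "\<delta> / 2 < dist z y" if "e \<bullet> y \<le> l0" for y
          using \<delta>(2)[of y] \<delta>(1) that by linarith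
      qed
      from half_space_mass[OF e _ _ r(1) _ klow this] show ?thesis using ez r by simp
    qed
    have "(b - a) * ?I - a * \<Theta> powr q * integral\<^sup>L lebesgue (trunc_power q z r) \<le> J"
    proof (rule principal_value_lower_bound[OF e l w(1) odd _ r(1) _ a(1) b0 b lower strip \<delta> J])
      show "k (hyperplane_reflection e l y - z) \<le> k (y - z)" if "l < e \<bullet> y" "y \<noteq> z" for y
      proof -
        have "l < e \<bullet> z" using l ez r by linarith
        have "A *v (matrix_inv A *v (y - z)) = y - z" using admissible_inverse(1)[OF A \<theta>(1)] .
        then have "matrix_inv A *v (y - z) \<noteq> 0" using that by auto
        moreover have "0 \<le> q" using s q by simp
        ultimately show ?thesis
          unfolding k_def
          using admissible_inverse_reflection[OF A \<theta>(1) e \<open>l < e \<bullet> z\<close> that(1)]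
          by (intro powr_mono2') auto
      qed
      show "r \<le> e \<bullet> x - l0" using r by simp
    qed
    moreover have "(b - a) * (\<theta> powr q * 5 powr (-q) * unit_ball_vol (real CARD('n)) * r powr (- 2 * s)) \<le> (b - a) * ?I"
      using I a by (intro mult_left_mono) auto
    moreover have "a * \<Theta> powr q * integral\<^sup>L lebesgue (trunc_power q z r) \<le> a * \<Theta> powr q * (C * r powr (- 2 * s))"
      using C a by (intro mult_left_mono) auto
    ultimately have "((b - a) * (\<theta> powr q * 5 powr (-q) * unit_ball_vol (real CARD('n))) - a * (\<Theta> powr q * C))
      * r powr (- 2 * s) \<le> J"
      by (simp add: algebra_simps)
    then show "((b - a) * (\<theta> powr q * 5 powr (-q) * unit_ball_vol (real CARD('n))) - a * (\<Theta> powr q * C))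
      * r powr (- 2 * s) \<le> pv_integral z (\<lambda>y. (w y - w z) /
          norm (matrix_inv A *v (y - z)) powr (real CARD('n) + 2 * s))"
      unfolding k_eq pv .
  qed
qed

section \<open>The perturbed minimum and the contradiction at a far away point\<close>

text \<open>Minimize over the compact set \<open>closure \<Omega> \<inter> cball x r\<close>,
  contained in the half-space. The value at \<open>x\<close> is below \<open>- M\<close>; off
  \<open>\<Omega>\<close> the perturbed function is at least \<open>- a > - M\<close>, and at points
  of \<open>\<Omega>\<close> where the bump vanishes it is at least \<open>- M\<close>. So the
  minimizer lies in \<open>\<Omega>\<close>, inside the open ball, and is global.\<close>

lemma perturbed_minimum:
  fixes w :: "'a::euclidean_space \<Rightarrow> real"
  assumes e: "norm e = 1" and l: "l \<le> l0" and r: "0 < r" "2 * r = e \<bullet> x - l0"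
    and lsc: "lower_semicontinuous_on (closure \<Omega> \<inter> {y. l < e \<bullet> y}) w"
    and M: "\<And>y. y \<in> \<Omega> \<Longrightarrow> - M \<le> w y"
    and a: "0 \<le> a" "a < M" and x: "x \<in> \<Omega>" "w x - a < - M"
    and out: "\<And>y. l < e \<bullet> y \<Longrightarrow> y \<notin> \<Omega> \<Longrightarrow> 0 \<le> w y"
  obtains z where "z \<in> \<Omega>" "dist x z < r" "w z - a * bump x r z < - M"
    "\<And>y. l < e \<bullet> y \<Longrightarrow> w z - a * bump x r z \<le> w y - a * bump x r y"
proof -
  let ?v = "\<lambda>y. w y - a * bump x r y"
  let ?S = "closure \<Omega> \<inter> cball x r"
  have half: "l < e \<bullet> y" if "y \<in> cball x r" for y
  proof -
    have "e \<bullet> (x - y) \<le> norm e * norm (x - y)" by (rule norm_cauchy_schwarz)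
    then show ?thesis using e r l that by (simp add: inner_diff_right dist_norm)
  qed
  have x_S: "x \<in> ?S" using x r closure_subset[of \<Omega>] by auto
  have vx: "?v x < - M" using x r by (simp add: bump_def)
  have av: "a * bump x r y \<le> a" for y
    using mult_left_mono[OF bump_bounds(2)[of x r y] a(1)] by simp
  have "lower_semicontinuous_on ?S ?v"
  proof (rule lower_semicontinuous_on_diff_continuous)
    show "lower_semicontinuous_on ?S w"
      using lsc by (rule lower_semicontinuous_on_subset) (use half in auto)
    show "continuous_on ?S (\<lambda>y. a * bump x r y)"
      unfolding bump_def by (intro continuous_intros) (use r in simp)
  qed
  moreover have "compact ?S" by (intro closed_Int_compact) auto
  ultimately obtain z where z: "z \<in> ?S" "\<And>y. y \<in> ?S \<Longrightarrow> ?v z \<le> ?v y"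
    using lower_semicontinuous_attains_inf[of ?S ?v] x_S by blast
  have vz: "?v z < - M" using z(2)[OF x_S] vx by linarith
  have z_\<Omega>: "z \<in> \<Omega>"
  proof (rule ccontr)
    assume "z \<notin> \<Omega>"
    then have "0 \<le> w z" using out half z(1) by auto
    then show False using vz av[of z] a by linarith
  qed
  have "dist x z < r"
  proof (rule ccontr)
    assume "\<not> dist x z < r"
    then have "bump x r z = 0" using r by (intro bump_outside) auto
    then show False using vz M[OF z_\<Omega>] by simp
  qed
  moreover have "?v z \<le> ?v y" if y: "l < e \<bullet> y" for y
  proof (cases "y \<in> \<Omega>")
    case False
    then show ?thesis using vz av[of y] a out[OF y] by fastforce
  next
    case True
    show ?thesis
    proof (cases "dist x y \<le> r")
      case False
      then have "bump x r y = 0" using r by (intro bump_outside) auto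
      then show ?thesis using vz M[OF True] by simp
    next
      case inside: True
      then show ?thesis using True closure_subset[of \<Omega>] by (intro z(2)) auto
    qed
  qed
  ultimately show ?thesis using that z_\<Omega> vz by blast
qed

text \<open>The choice of \<open>\<eta>\<close> makes
  \<open>\<eta> * (C0 + \<Theta> powr q * C) = C0 / 2\<close>: with bump height
  \<open>\<eta> * M\<close>, half of the gain \<open>M * C0\<close> is left. The factor
  \<open>1 - \<eta> / 2\<close> lets the perturbation push the value at \<open>x\<close> strictly
  below \<open>- M\<close>.\<close>

lemma almost_minimum_bounded:
  fixes w c :: "real^'n \<Rightarrow> real" and e x :: "real^'n" and s l \<theta> \<Theta> C R1 :: real
    and \<Omega> :: "(real^'n) set"
  defines "q \<equiv> real CARD('n) + 2 * s"
  defines "C0 \<equiv> \<theta> powr q * 5 powr (-q) * unit_ball_vol (real CARD('n))"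
  defines "\<eta> \<equiv> C0 / (2 * (C0 + \<Theta> powr q * C))"
  defines "l0 \<equiv> INF y\<in>\<Omega>. e \<bullet> y"
  assumes n: "CARD('n) \<ge> 2" and s: "0 < s" "s < 1" and \<theta>: "0 < \<theta>" "\<theta> \<le> \<Theta>"
    and C: "0 \<le> C" "\<And>(z :: real^'n) r. 0 < r \<Longrightarrow> integral\<^sup>L lebesgue (trunc_power q z r) \<le> C * r powr (- 2 * s)"
    and e: "norm e = 1" and \<Omega>: "open \<Omega>" "\<Omega> \<subseteq> {y. l < e \<bullet> y}"
    and R1: "\<And>y. y \<in> \<Omega> \<Longrightarrow> w y < 0 \<Longrightarrow> R1 \<le> norm y \<Longrightarrow> - (C0 / 2) / 4 < norm y powr (2 * s) * c y"
    and w: "w \<in> Ls_space s" "w \<in> C11_loc \<Omega>" "bdd_below (range w)"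
    and lsc: "lower_semicontinuous_on (closure \<Omega> \<inter> {y. l < e \<bullet> y}) w"
    and F: "\<And>y. y \<in> \<Omega> \<Longrightarrow> w y < 0 \<Longrightarrow> Fs s \<theta> \<Theta> e w y - c y * w y \<le> 0"
    and out: "\<And>y. l < e \<bullet> y \<Longrightarrow> y \<notin> \<Omega> \<Longrightarrow> 0 \<le> w y"
    and odd: "\<And>y. l < e \<bullet> y \<Longrightarrow> w (hyperplane_reflection e l y) = - w y"
    and x: "x \<in> \<Omega>" "w x \<le> (1 - \<eta> / 2) * (INF y\<in>\<Omega>. w y)" "(INF y\<in>\<Omega>. w y) < 0"
  shows "norm x \<le> 2 * max R1 \<bar>l0\<bar> + \<bar>l0\<bar>"
proof (rule ccontr)
  assume "\<not> norm x \<le> 2 * max R1 \<bar>l0\<bar> + \<bar>l0\<bar>"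
  then have x_far: "2 * max R1 \<bar>l0\<bar> + \<bar>l0\<bar> < norm x" by simp
  have C0: "0 < C0"
    unfolding C0_def using \<theta> by (intro mult_pos_pos unit_ball_vol_pos) auto
  have C1: "0 \<le> \<Theta> powr q * C" using C by simp
  have \<eta>: "0 < \<eta>" "\<eta> < 1" "\<eta> * (C0 + \<Theta> powr q * C) = C0 / 2"
    unfolding \<eta>_def using C0 C1 by (auto simp: field_simps intro!: add_pos_nonneg) 
  define M where "M = - (INF y\<in>\<Omega>. w y)"
  define a where "a = \<eta> * M"
  have M: "0 < M" "- M \<le> w y" if "y \<in> \<Omega>" for y
    using x that w(3) by (auto simp: M_def intro!: cINF_lower bdd_below_mono[OF w(3)])
  note M0 = M(1)[OF x(1)]
  have a: "0 \<le> a" "a < M" using \<eta> M0 by (auto simp: a_def)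
  have bdd: "bdd_below ((\<bullet>) e ` \<Omega>)"
    using \<Omega>(2) by (intro bdd_belowI2[of _ l]) auto
  have l0_le: "l0 \<le> e \<bullet> y" if "y \<in> \<Omega>" for y
    unfolding l0_def using bdd that by (rule cINF_lower)
  have l: "l \<le> l0"
    unfolding l0_def using x(1) \<Omega>(2) by (intro cINF_greatest) auto
  define r where "r = (e \<bullet> x - l0) / 2"
  \<comment> \<open>A nonzero linear functional does not attain its infimum on an open set.\<close>
  have "l0 < e \<bullet> x"
  proof -
    obtain t where t: "0 < t" "ball x t \<subseteq> \<Omega>" using \<Omega>(1) x(1) open_contains_ball by blast
    have "x - (t / 2) *\<^sub>R e \<in> \<Omega>" using t e by (intro subsetD[OF t(2)]) (simp add: dist_norm)
    from l0_le[OF this] show ?thesis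
      using t e by (simp add: inner_diff_right norm_eq_1)
  qed
  then have r: "0 < r" "2 * r = e \<bullet> x - l0" by (simp_all add: r_def)
  have "w x - a < - M"
    using x(2) mult_pos_pos[OF \<eta>(1) M0] by (simp add: M_def a_def algebra_simps)
  then obtain z where z: "z \<in> \<Omega>" "dist x z < r" "w z - a * bump x r z < - M"
    and z_min: "\<And>y. l < e \<bullet> y \<Longrightarrow> w z - a * bump x r z \<le> w y - a * bump x r y"
    using perturbed_minimum[OF e l r lsc M(2) a x(1) _ out] by blast
  define b where "b = a * bump x r z - w z"
  have b: "M < b" using z(3) by (simp add: b_def)
  have wz: "w z < 0"
    using z(3) mult_left_mono[OF bump_bounds(2)[of x r z] a(1)] a(2) by simp
  have "((b - a) * C0 - a * (\<Theta> powr q * C)) * r powr (- 2 * s) \<le> Fs s \<theta> \<Theta> e w z"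
    unfolding C0_def q_def
  proof (rule Fs_lower_bound[OF n s \<theta> e l w(1,2) z(1) wz z(2) odd r a(1) _ b_def])
    show "a \<le> b" using a b by simp
    show "- b \<le> w y - a * bump x r y" if "l < e \<bullet> y" for y
      using z_min[OF that] by (simp add: b_def)
    show "0 \<le> w y" if "l < e \<bullet> y" "e \<bullet> y \<le> l0" for y
    proof (cases "y \<in> \<Omega>")
      case False
      then show ?thesis using out that by blast
    next
      \<comment> \<open>This case is contradictory, again because \<open>\<Omega>\<close> is open:
        no point of it has height at most \<open>l0\<close>.\<close>
      case True
      obtain t where t: "0 < t" "ball y t \<subseteq> \<Omega>" using \<Omega>(1) True open_contains_ball by blast
      have "y - (t / 2) *\<^sub>R e \<in> \<Omega>" using t e by (intro subsetD[OF t(2)]) (simp add: dist_norm)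
      from l0_le[OF this] show ?thesis
        using t e that by (simp add: inner_diff_right norm_eq_1)
    qed
    show "integral\<^sup>L lebesgue (trunc_power (real CARD('n) + 2 * s) z r) \<le> C * r powr (- 2 * s)"
      using C(2)[OF r(1)] by (simp add: q_def)
  qed
  also have "\<dots> \<le> c z * w z" using F[OF z(1) wz] by simp
  also have "\<dots> < C0 / 2 * M * r powr (- 2 * s)"
  proof -
    \<comment> \<open>Since \<open>2 * r\<close> is at most \<open>norm x + \<bar>l0\<bar>\<close>
      and \<open>norm x < norm z + r\<close>, the distance assumption on \<open>x\<close> makes
      \<open>norm z\<close> exceed both \<open>R1\<close> and \<open>\<bar>l0\<bar>\<close>. The
      former activates the bound on \<open>c\<close>, the latter yields
      \<open>r \<le> 2 * norm z\<close>.\<close>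
    have "\<bar>e \<bullet> x\<bar> \<le> norm x" using Cauchy_Schwarz_ineq2[of e x] e by simp
    then have "2 * r \<le> norm x + \<bar>l0\<bar>" using r(2) by linarith
    moreover have "norm x \<le> norm z + dist x z"
      by (metis dist_norm norm_triangle_sub)
    ultimately have z_far: "max R1 \<bar>l0\<bar> < norm z" using z(2) x_far by linarith
    have z0: "0 < norm z" using z_far by linarith
    have "\<bar>e \<bullet> (x - z)\<bar> \<le> norm e * norm (x - z)" by (rule Cauchy_Schwarz_ineq2)
    then have "e \<bullet> x - r \<le> e \<bullet> z" using e z(2) by (simp add: inner_diff_right dist_norm)
    moreover have "e \<bullet> z \<le> norm z" using norm_cauchy_schwarz[of e z] e by simp
    ultimately have rz: "r \<le> 2 * norm z" using r z_far by linarith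
    have "- (C0 / 2) / 4 < norm z powr (2 * s) * c z"
      using R1[OF z(1) wz] z_far by simp
    then have "- (C0 / 8) * norm z powr (- 2 * s) < (norm z powr (2 * s) * c z) * norm z powr (- 2 * s)"
      using z0 by (intro mult_strict_right_mono) auto
    also have "\<dots> = c z" using z0 by (simp add: powr_minus)
    finally have cz: "- c z < C0 / 8 * norm z powr (- 2 * s)" by simp
    have "c z * w z = (- c z) * (- w z)" by simp
    also have "\<dots> < (C0 / 8 * norm z powr (- 2 * s)) * (- w z)"
      using cz wz by (intro mult_strict_right_mono) auto
    also have "\<dots> \<le> (C0 / 8 * norm z powr (- 2 * s)) * M"
      using M(2)[OF z(1)] C0 by (intro mult_left_mono) auto
    also have "\<dots> \<le> (C0 / 8 * (4 * r powr (- 2 * s))) * M"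
    proof -
      \<comment> \<open>The factor 4 bounds \<open>2 powr (2 * s)\<close>, as \<open>s < 1\<close>;
        it turns \<open>C0 / 8\<close> into \<open>C0 / 2\<close>.\<close>
      have "norm z powr (- 2 * s) = 2 powr (2 * s) * (2 * norm z) powr (- 2 * s)"
        by (simp add: powr_mult powr_minus)
      also have "\<dots> \<le> 2 powr 2 * r powr (- 2 * s)"
        using rz r(1) s by (intro mult_mono powr_mono powr_mono2') auto
      finally show ?thesis using C0 M0 by (intro mult_left_mono mult_right_mono) auto
    qed
    finally show ?thesis by (simp add: mult_ac)
  qed
  finally have "((b - a) * C0 - a * (\<Theta> powr q * C)) * r powr (- 2 * s) < C0 / 2 * M * r powr (- 2 * s)" .
  then have "(b - a) * C0 - a * (\<Theta> powr q * C) < C0 / 2 * M"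
    using r(1) by (simp add: mult_less_cancel_right)
  moreover have "(M - a) * C0 \<le> (b - a) * C0" using b C0 by (intro mult_right_mono) auto
  \<comment> \<open>By the choice of \<open>\<eta>\<close> this equals \<open>M * C0 / 2\<close>,
    against the strict upper bound just obtained.\<close>
  moreover have "(M - a) * C0 - a * (\<Theta> powr q * C) = M * C0 - M * (\<eta> * (C0 + \<Theta> powr q * C))"
    by (simp add: a_def algebra_simps)
  ultimately show False unfolding \<eta>(3) by (simp add: algebra_simps)
qed

text \<open>Together with \<open>hyperplane_reflection_minus\<close>, this reduces the half-space
  below the hyperplane to the one above it, with \<open>- e\<close> and \<open>- l\<close> in place
  of \<open>e\<close> and \<open>l\<close>.\<close>

lemma Fs_minus:
  fixes e :: "real^'n"
  shows "Fs s \<theta> \<Theta> (- e) = Fs s \<theta> \<Theta> e"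
proof -
  have "A *v (- e) = \<mu> *\<^sub>R (- e) \<longleftrightarrow> A *v e = \<mu> *\<^sub>R e" for A :: "real^'n^'n" and \<mu>
    using matrix_vector_mult_scaleR[of A "-1" e] by simp
  then have "admissible \<theta> \<Theta> (- e) = admissible \<theta> \<Theta> e" by (simp add: admissible_def)
  then show ?thesis by (simp add: Fs_def fun_eq_iff)
qed

lemma hyperplane_reflection_minus:
  "hyperplane_reflection (- e) (- l) x = hyperplane_reflection e l x"
  by (simp add: hyperplane_reflection_def scaleR_left_distrib[symmetric] algebra_simps)

theorem theorem2p12:
  fixes s \<theta> :: real
  assumes "CARD('n::finite) \<ge> 2" and "0 < s" and "s < 1" and "0 < \<theta>"
  shows "\<exists>C>0. \<forall>\<Theta>\<ge>\<theta>. \<forall>(e :: real^'n) \<Omega> (c :: real^'n \<Rightarrow> real) N.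
    norm e = 1 \<longrightarrow> open \<Omega> \<longrightarrow> \<not> bounded \<Omega> \<longrightarrow> N \<subseteq> \<Omega> \<longrightarrow>
    Liminf (inf at_infinity (principal N)) (\<lambda>x. ereal (norm x powr (2 * s) * c x))
      > ereal (- C / 4) \<longrightarrow>
    (\<exists>R0>0. \<exists>\<alpha>0. 0 < \<alpha>0 \<and> \<alpha>0 < 1 \<and>
      (\<forall>l \<Sigma> w.
        (\<Sigma> = {x. e \<bullet> x < l} \<or> \<Sigma> = {x. e \<bullet> x > l}) \<longrightarrow>
        \<Omega> \<subseteq> \<Sigma> \<longrightarrow>
        w \<in> Ls_space s \<inter> C11_loc \<Omega> \<longrightarrow>
        bdd_below (range w) \<longrightarrow>
        lower_semicontinuous_on (closure \<Omega> \<inter> \<Sigma>) w \<longrightarrow>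
        {x\<in>\<Omega>. w x < 0} \<subseteq> N \<longrightarrow>
        (\<forall>x\<in>\<Omega>. w x < 0 \<longrightarrow> Fs s \<theta> \<Theta> e w x - c x * w x \<le> 0) \<longrightarrow>
        (\<forall>x\<in>\<Sigma> - \<Omega>. w x \<ge> 0) \<longrightarrow>
        (\<forall>x\<in>\<Sigma>. w (hyperplane_reflection e l x) = - w x) \<longrightarrow>
        (\<forall>xh\<in>\<Omega>. w xh \<le> \<alpha>0 * (INF x\<in>\<Omega>. w x) \<and> \<alpha>0 * (INF x\<in>\<Omega>. w x) < 0
           \<longrightarrow> norm xh \<le> R0)))"
proof -
  note s = assms(2,3)
  define q where "q = real CARD('n) + 2 * s"
  define C0 where "C0 = \<theta> powr q * 5 powr (-q) * unit_ball_vol (real CARD('n))"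
  have C0: "0 < C0"
    unfolding C0_def using assms(4) by (intro mult_pos_pos unit_ball_vol_pos) auto
  obtain K where K: "0 \<le> K"
    "\<And>(z :: real^'n) r. 0 < r \<Longrightarrow> integral\<^sup>L lebesgue (trunc_power q z r) \<le> K * r powr (- 2 * s)"
  proof -
    have "real DIM(real^'n) < q" "q < real DIM(real^'n) + 2" "2 \<le> q"
      using assms by (auto simp: q_def)
    then show ?thesis
    proof (rule truncated_kernel_integrable)
      fix K assume "0 \<le> K" and
        "\<And>(z :: real^'n) r. 0 < r \<Longrightarrow> integral\<^sup>L lebesgue (trunc_power q z r) \<le> K * r powr (real DIM(real^'n) - q)"
      then show ?thesis using that[of K] by (simp add: q_def)
    qed
  qed
  \<comment> \<open>\<open>C0\<close> involves only the dimension, \<open>s\<close> and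
    \<open>\<theta>\<close>; the dependence of the error term on \<open>\<Theta>\<close> is absorbed
    later by \<open>\<eta>\<close>. A quarter of \<open>C0 / 2\<close> is the margin that the
    contradiction uses.\<close>
  show ?thesis
  proof (rule exI[of _ "C0 / 2"], intro conjI allI impI)
    show "0 < C0 / 2" using C0 by simp
    fix \<Theta> :: real and e :: "real^'n" and \<Omega> :: "(real^'n) set" and c :: "real^'n \<Rightarrow> real" and N
    assume \<Theta>: "\<theta> \<le> \<Theta>" and e: "norm e = 1" and \<Omega>: "open \<Omega>"
      and liminf: "Liminf (inf at_infinity (principal N)) (\<lambda>x. ereal (norm x powr (2 * s) * c x))
        > ereal (- (C0 / 2) / 4)"
    have "\<forall>\<^sub>F x in at_infinity. x \<in> N \<longrightarrow> - (C0 / 2) / 4 < norm x powr (2 * s) * c x"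
      using less_LiminfD[OF liminf] by (simp add: eventually_inf_principal)
    \<comment> \<open>\<open>R1\<close> comes from \<open>N\<close> and \<open>c\<close> before
      \<open>w\<close> and the half-space are chosen, which makes the final radius uniform in
      them.\<close>
    then obtain R1 where R1: "\<And>x. R1 \<le> norm x \<Longrightarrow> x \<in> N \<Longrightarrow> - (C0 / 2) / 4 < norm x powr (2 * s) * c x"
      unfolding eventually_at_infinity by blast
    \<comment> \<open>Only the direction and \<open>\<Omega>\<close> enter, not the position
      \<open>l\<close>. If \<open>f \<bullet> y\<close> is unbounded below on
      \<open>\<Omega>\<close>, the \<open>INF\<close> is a default value, harmless because then no
      half-space \<open>{y. l < f \<bullet> y}\<close> contains \<open>\<Omega>\<close>.\<close>
    define R where "R f = 2 * max R1 \<bar>INF y\<in>\<Omega>. f \<bullet> y\<bar> + \<bar>INF y\<in>\<Omega>. f \<bullet> y\<bar>" for f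
    define \<eta> where "\<eta> = C0 / (2 * (C0 + \<Theta> powr q * K))"
    have "0 < C0 + \<Theta> powr q * K" using C0 K(1) by (intro add_pos_nonneg) auto
    moreover have "0 \<le> \<Theta> powr q * K" using K(1) by simp
    ultimately have \<eta>: "0 < \<eta>" "\<eta> < 1"
      unfolding \<eta>_def using C0 by (auto simp: field_simps)
    have one_side: "norm x \<le> R f"
      if f: "norm f = 1" and sub: "\<Omega> \<subseteq> {y. l < f \<bullet> y}"
        and w: "w \<in> Ls_space s" "w \<in> C11_loc \<Omega>" "bdd_below (range w)"
        and lsc: "lower_semicontinuous_on (closure \<Omega> \<inter> {y. l < f \<bullet> y}) w"
        and neg: "{x\<in>\<Omega>. w x < 0} \<subseteq> N"
        and F: "\<forall>x\<in>\<Omega>. w x < 0 \<longrightarrow> Fs s \<theta> \<Theta> f w x - c x * w x \<le> 0"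
        and out: "\<forall>x\<in>{y. l < f \<bullet> y} - \<Omega>. w x \<ge> 0"
        and odd: "\<forall>x\<in>{y. l < f \<bullet> y}. w (hyperplane_reflection f l x) = - w x"
        and x: "x \<in> \<Omega>" "w x \<le> (1 - \<eta> / 2) * (INF x\<in>\<Omega>. w x)" "(1 - \<eta> / 2) * (INF x\<in>\<Omega>. w x) < 0"
      for f l w x
    proof -
      have "(INF x\<in>\<Omega>. w x) < 0" using x(3) \<eta> by (simp add: mult_less_0_iff)
      with x(2) show ?thesis
        unfolding R_def \<eta>_def C0_def q_def
        by (intro almost_minimum_bounded[OF assms(1) s assms(4) \<Theta> K(1) _ f \<Omega> sub _ w lsc])
          (use K(2) R1 neg F out odd x(1) in \<open>auto simp: q_def C0_def\<close>)
    qed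
    show "\<exists>R0>0. \<exists>\<alpha>0. 0 < \<alpha>0 \<and> \<alpha>0 < 1 \<and>
      (\<forall>l \<Sigma> w.
        (\<Sigma> = {x. e \<bullet> x < l} \<or> \<Sigma> = {x. e \<bullet> x > l}) \<longrightarrow>
        \<Omega> \<subseteq> \<Sigma> \<longrightarrow>
        w \<in> Ls_space s \<inter> C11_loc \<Omega> \<longrightarrow>
        bdd_below (range w) \<longrightarrow>
        lower_semicontinuous_on (closure \<Omega> \<inter> \<Sigma>) w \<longrightarrow>
        {x\<in>\<Omega>. w x < 0} \<subseteq> N \<longrightarrow>
        (\<forall>x\<in>\<Omega>. w x < 0 \<longrightarrow> Fs s \<theta> \<Theta> e w x - c x * w x \<le> 0) \<longrightarrow>
        (\<forall>x\<in>\<Sigma> - \<Omega>. w x \<ge> 0) \<longrightarrow>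
        (\<forall>x\<in>\<Sigma>. w (hyperplane_reflection e l x) = - w x) \<longrightarrow>
        (\<forall>xh\<in>\<Omega>. w xh \<le> \<alpha>0 * (INF x\<in>\<Omega>. w x) \<and> \<alpha>0 * (INF x\<in>\<Omega>. w x) < 0
           \<longrightarrow> norm xh \<le> R0))"
    \<comment> \<open>One radius has to serve both orientations, hence the sum; the summand 1 makes
      it positive.\<close>
    proof (rule exI[of _ "\<bar>R e\<bar> + \<bar>R (- e)\<bar> + 1"], rule conjI[OF _ exI[of _ "1 - \<eta> / 2"]],
        goal_cases)
      case 2
      show ?case
      proof (intro conjI allI impI ballI)
        fix l \<Sigma> w x
        assume \<Sigma>: "\<Sigma> = {x. e \<bullet> x < l} \<or> \<Sigma> = {x. e \<bullet> x > l}" and sub: "\<Omega> \<subseteq> \<Sigma>"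
          and w: "w \<in> Ls_space s \<inter> C11_loc \<Omega>" "bdd_below (range w)"
          and lsc: "lower_semicontinuous_on (closure \<Omega> \<inter> \<Sigma>) w"
          and neg: "{x\<in>\<Omega>. w x < 0} \<subseteq> N"
          and F: "\<forall>x\<in>\<Omega>. w x < 0 \<longrightarrow> Fs s \<theta> \<Theta> e w x - c x * w x \<le> 0"
          and out: "\<forall>x\<in>\<Sigma> - \<Omega>. w x \<ge> 0"
          and odd: "\<forall>x\<in>\<Sigma>. w (hyperplane_reflection e l x) = - w x"
          and x: "x \<in> \<Omega>" "w x \<le> (1 - \<eta> / 2) * (INF x\<in>\<Omega>. w x) \<and> (1 - \<eta> / 2) * (INF x\<in>\<Omega>. w x) < 0"
        from \<Sigma> show "norm x \<le> \<bar>R e\<bar> + \<bar>R (- e)\<bar> + 1"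
        proof
          assume eq: "\<Sigma> = {x. e \<bullet> x > l}"
          have "norm x \<le> R e"
            by (rule one_side[of e l w x]) (use e sub w lsc neg F out odd x eq in auto)
          then show ?thesis by linarith
        next
          assume "\<Sigma> = {x. e \<bullet> x < l}"
          then have eq: "\<Sigma> = {y. - l < (- e) \<bullet> y}" by simp
          have "norm x \<le> R (- e)"
          proof (rule one_side[of "- e" "- l" w x, folded eq])
            show "\<forall>x\<in>\<Sigma>. w (hyperplane_reflection (- e) (- l) x) = - w x"
              using odd by (simp add: hyperplane_reflection_minus)
            show "\<forall>x\<in>\<Omega>. w x < 0 \<longrightarrow> Fs s \<theta> \<Theta> (- e) w x - c x * w x \<le> 0"
              using F by (simp add: Fs_minus)
          qed (use e sub w lsc neg out x in auto)
          then show ?thesis by linarith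
        qed
      qed (use \<eta> in auto)
    qed linarith
  qed
qed

end
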